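(* There exists a non-trivial shrinking generalized soliton on $S^2\times\mathbb{R}$. That is, there exist a Riemannian metric $g$, a closed $3$-form $H\neq0$, a vector field $X$ on $S^2\times\mathbb{R}$ and a constant $\lambda>0$ such that $$2\operatorname{Ric}_g-\tfrac12H^2=\lambda g-\mathcal{L}_Xg,\qquad \Delta_dH=\lambda H-\mathcal{L}_XH .$$
   Context: $(H^2)_{ij}=g^{pq}g^{kl}H_{ipk}H_{jql}$, $\Delta_d=dd^*+d^*d$ is the Hodge Laplacian of $g$, $\mathcal{L}$ is the Lie derivative. A generalized soliton is a solution $(g,H,X,\lambda)$ of the displayed system with $H$ a closed $3$-form; it is shrinking if $\lambda>0$, and non-trivial if $H\neq0$. *)

theory Defs
  imports "HOL-Analysis.Analysis"
begin

section \<open>Smooth maps on open subsets of coordinate space\<close>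

definition pderiv_dir :: "'n::finite \<Rightarrow> (real^'n \<Rightarrow> 'b::real_normed_vector) \<Rightarrow> real^'n \<Rightarrow> 'b"
  where "pderiv_dir i f x = frechet_derivative f (at x) (axis i 1)"

text \<open>The following is only used for open \<open>V\<close>.\<close>

primrec C_on :: "nat \<Rightarrow> (real^'n::finite) set \<Rightarrow> (real^'n \<Rightarrow> 'b::real_normed_vector) \<Rightarrow> bool"
  where
    "C_on 0 V f \<longleftrightarrow> continuous_on V f"
  | "C_on (Suc k) V f \<longleftrightarrow> f differentiable_on V \<and> (\<forall>i. C_on k V (pderiv_dir i f))"

definition smooth_map_on :: "(real^'n::finite) set \<Rightarrow> (real^'n \<Rightarrow> 'b::real_normed_vector) \<Rightarrow> bool"
  where "smooth_map_on V f \<longleftrightarrow> (\<forall>k. C_on k V f)"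

section \<open>Embedded submanifolds of a Euclidean space\<close>

text \<open>
  A manifold is a subset \<open>M\<close> of a Euclidean space that is covered by (inverses of) charts. The
  dimension is \<open>CARD('n)\<close>; where the type \<open>'n\<close> cannot be inferred it is passed as \<open>TYPE('n)\<close>.
\<close>

definition local_parametrization ::
  "'a::euclidean_space set \<Rightarrow> (real^'n::finite) set \<Rightarrow> (real^'n \<Rightarrow> 'a) \<Rightarrow> bool"
  where "local_parametrization M V \<psi> \<longleftrightarrow>
    open V \<and> smooth_map_on V \<psi> \<and> (\<forall>x\<in>V. inj (frechet_derivative \<psi> (at x))) \<and>
    openin (top_of_set M) (\<psi> ` V) \<and> (\<exists>\<phi>. homeomorphism V (\<psi> ` V) \<psi> \<phi>)"

definition smooth_submanifold :: "'n::finite itself \<Rightarrow> 'a::euclidean_space set \<Rightarrow> bool"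
  where "smooth_submanifold _ M \<longleftrightarrow>
    (\<forall>p\<in>M. \<exists>V (\<psi> :: real^'n \<Rightarrow> 'a). local_parametrization M V \<psi> \<and> p \<in> \<psi> ` V)"

definition tangent_space :: "'a::euclidean_space set \<Rightarrow> 'a \<Rightarrow> 'a set"
  where "tangent_space M p =
    {v. \<exists>\<gamma> e. 0 < e \<and> \<gamma> ` {-e<..<e} \<subseteq> M \<and> \<gamma> 0 = p \<and> (\<gamma> has_vector_derivative v) (at (0::real))}"

section \<open>Tensor fields on submanifolds\<close>

text \<open>
  A covariant tensor field of rank \<open>k\<close> assigns to each point \<open>p\<close> of \<open>M\<close> a multilinear form on the
  tangent space, applied to the list of its \<open>k\<close> arguments. Its values at points outside \<open>M\<close>,
  on vectors that are not tangent and on lists of another length are irrelevant.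
\<close>

type_synonym 'a covariant_tensor = "'a \<Rightarrow> 'a list \<Rightarrow> real"

text \<open>Components in coordinates: the list consists of the lower indices.\<close>

type_synonym 'n components = "'n list \<Rightarrow> real^'n \<Rightarrow> real"

definition components_in ::
  "(real^'n::finite \<Rightarrow> 'a::euclidean_space) \<Rightarrow> 'a covariant_tensor \<Rightarrow> 'n components"
  where "components_in \<psi> T is x = T (\<psi> x) (map (\<lambda>i. pderiv_dir i \<psi> x) is)"

definition tensor_field ::
  "'n::finite itself \<Rightarrow> nat \<Rightarrow> 'a::euclidean_space set \<Rightarrow> 'a covariant_tensor \<Rightarrow> bool"
  where "tensor_field _ k M T \<longleftrightarrow>
    (\<forall>p\<in>M. \<forall>vs. length vs = k \<and> set vs \<subseteq> tangent_space M p \<longrightarrow>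
      (\<forall>j<k. \<forall>u\<in>tangent_space M p. \<forall>w\<in>tangent_space M p. \<forall>a b.
        T p (vs[j := a *\<^sub>R u + b *\<^sub>R w]) = a * T p (vs[j := u]) + b * T p (vs[j := w]))) \<and>
    (\<forall>V (\<psi> :: real^'n \<Rightarrow> 'a). local_parametrization M V \<psi> \<longrightarrow>
      (\<forall>is. length is = k \<longrightarrow> smooth_map_on V (components_in \<psi> T is)))"

definition differential_form ::
  "'n::finite itself \<Rightarrow> nat \<Rightarrow> 'a::euclidean_space set \<Rightarrow> 'a covariant_tensor \<Rightarrow> bool"
  where "differential_form d k M \<omega> \<longleftrightarrow> tensor_field d k M \<omega> \<and>
    (\<forall>p\<in>M. \<forall>vs. length vs = k \<and> set vs \<subseteq> tangent_space M p \<and> \<not> distinct vs \<longrightarrow> \<omega> p vs = 0)"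

definition riemannian_metric ::
  "'n::finite itself \<Rightarrow> 'a::euclidean_space set \<Rightarrow> 'a covariant_tensor \<Rightarrow> bool"
  where "riemannian_metric d M g \<longleftrightarrow> tensor_field d 2 M g \<and>
    (\<forall>p\<in>M. \<forall>u\<in>tangent_space M p. \<forall>v\<in>tangent_space M p. g p [u, v] = g p [v, u]) \<and>
    (\<forall>p\<in>M. \<forall>v\<in>tangent_space M p. v \<noteq> 0 \<longrightarrow> g p [v, v] > 0)"

definition vector_field ::
  "'n::finite itself \<Rightarrow> 'a::euclidean_space set \<Rightarrow> ('a \<Rightarrow> 'a) \<Rightarrow> bool"
  where "vector_field _ M X \<longleftrightarrow> (\<forall>p\<in>M. X p \<in> tangent_space M p) \<and>
    (\<forall>V (\<psi> :: real^'n \<Rightarrow> 'a). local_parametrization M V \<psi> \<longrightarrow> smooth_map_on V (X \<circ> \<psi>))"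

definition vector_components ::
  "(real^'n::finite \<Rightarrow> 'a::euclidean_space) \<Rightarrow> ('a \<Rightarrow> 'a) \<Rightarrow> real^'n \<Rightarrow> real^'n"
  where "vector_components \<psi> X x =
    (THE c. X (\<psi> x) = (\<Sum>i\<in>UNIV. c $ i *\<^sub>R pderiv_dir i \<psi> x))"

definition nonzero_tensor :: "nat \<Rightarrow> 'a::euclidean_space set \<Rightarrow> 'a covariant_tensor \<Rightarrow> bool"
  where "nonzero_tensor k M T \<longleftrightarrow>
    (\<exists>p\<in>M. \<exists>vs. length vs = k \<and> set vs \<subseteq> tangent_space M p \<and> T p vs \<noteq> 0)"

section \<open>Tensor calculus in coordinates\<close>

text \<open>Below, \<open>G\<close> stands for the components of a metric.\<close>

definition inverse_metric :: "'n::finite components \<Rightarrow> 'n \<Rightarrow> 'n \<Rightarrow> real^'n \<Rightarrow> real"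
  where "inverse_metric G i j x = matrix_inv (\<chi> a b. G [a, b] x) $ i $ j"

text \<open>\<open>christoffel G k i j\<close> is $\Gamma^k_{ij}$.\<close>

definition christoffel :: "'n::finite components \<Rightarrow> 'n \<Rightarrow> 'n \<Rightarrow> 'n \<Rightarrow> real^'n \<Rightarrow> real"
  where "christoffel G k i j x = 1/2 * (\<Sum>l\<in>UNIV. inverse_metric G k l x *
    (pderiv_dir i (G [j, l]) x + pderiv_dir j (G [i, l]) x - pderiv_dir l (G [i, j]) x))"

text \<open>The sign is such that round spheres have positive Ricci curvature.\<close>

definition ricci :: "'n::finite components \<Rightarrow> 'n \<Rightarrow> 'n \<Rightarrow> real^'n \<Rightarrow> real"
  where "ricci G i j x =
    (\<Sum>k\<in>UNIV. pderiv_dir k (christoffel G k i j) x - pderiv_dir j (christoffel G k i k) x) +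
    (\<Sum>k\<in>UNIV. \<Sum>l\<in>UNIV. christoffel G k k l x * christoffel G l i j x
                      - christoffel G k j l x * christoffel G l i k x)"

definition covariant_derivative ::
  "'n::finite components \<Rightarrow> 'n \<Rightarrow> 'n components \<Rightarrow> 'n components"
  where "covariant_derivative G p T is x = pderiv_dir p (T is) x -
    (\<Sum>j<length is. \<Sum>m\<in>UNIV. christoffel G m p (is ! j) x * T (is[j := m]) x)"

definition lie_derivative ::
  "(real^'n::finite \<Rightarrow> real^'n) \<Rightarrow> 'n components \<Rightarrow> 'n components"
  where "lie_derivative Y T is x = (\<Sum>m\<in>UNIV. Y x $ m * pderiv_dir m (T is) x) +
    (\<Sum>j<length is. \<Sum>m\<in>UNIV. pderiv_dir (is ! j) (\<lambda>y. Y y $ m) x * T (is[j := m]) x)"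

definition exterior_derivative :: "'n::finite components \<Rightarrow> 'n components"
  where "exterior_derivative \<omega> is x =
    (\<Sum>j<length is. (-1) ^ j * pderiv_dir (is ! j) (\<omega> (take j is @ drop (Suc j) is)) x)"

text \<open>
  The formal adjoint $d^*$ of $d$: $(d^*\omega)_{i_2\ldots i_k} = -\nabla^p\omega_{p i_2\ldots i_k}$,
  for forms of degree \<open>k \<ge> 1\<close>.
\<close>

definition codifferential :: "'n::finite components \<Rightarrow> 'n components \<Rightarrow> 'n components"
  where "codifferential G \<omega> is x =
    - (\<Sum>p\<in>UNIV. \<Sum>q\<in>UNIV. inverse_metric G p q x * covariant_derivative G p \<omega> (q # is) x)"

definition hodge_laplacian :: "'n::finite components \<Rightarrow> 'n components \<Rightarrow> 'n components"
  where "hodge_laplacian G \<omega> is x =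
    exterior_derivative (codifferential G \<omega>) is x + codifferential G (exterior_derivative \<omega>) is x"

definition H_squared ::
  "'n::finite components \<Rightarrow> 'n components \<Rightarrow> 'n \<Rightarrow> 'n \<Rightarrow> real^'n \<Rightarrow> real"
  where "H_squared G H i j x = (\<Sum>p\<in>UNIV. \<Sum>q\<in>UNIV. \<Sum>k\<in>UNIV. \<Sum>l\<in>UNIV.
    inverse_metric G p q x * inverse_metric G k l x * H [i, p, k] x * H [j, q, l] x)"

section \<open>Generalized solitons\<close>

definition closed_form ::
  "'n::finite itself \<Rightarrow> nat \<Rightarrow> 'a::euclidean_space set \<Rightarrow> 'a covariant_tensor \<Rightarrow> bool"
  where "closed_form d k M \<omega> \<longleftrightarrow> differential_form d k M \<omega> \<and>
    (\<forall>V (\<psi> :: real^'n \<Rightarrow> 'a). local_parametrization M V \<psi> \<longrightarrow>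
      (\<forall>x\<in>V. \<forall>is. length is = Suc k \<longrightarrow>
        exterior_derivative (components_in \<psi> \<omega>) is x = 0))"

text \<open>The two tensor equations are required in all local coordinates.\<close>

definition generalized_soliton ::
  "'n::finite itself \<Rightarrow> 'a::euclidean_space set \<Rightarrow> 'a covariant_tensor \<Rightarrow> 'a covariant_tensor \<Rightarrow>
    ('a \<Rightarrow> 'a) \<Rightarrow> real \<Rightarrow> bool"
  where "generalized_soliton d M g H X lam \<longleftrightarrow>
    smooth_submanifold d M \<and> riemannian_metric d M g \<and> closed_form d 3 M H \<and>
    vector_field d M X \<and>
    (\<forall>V (\<psi> :: real^'n \<Rightarrow> 'a). local_parametrization M V \<psi> \<longrightarrow>
      (let G = components_in \<psi> g; K = components_in \<psi> H; Y = vector_components \<psi> X in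
        \<forall>x\<in>V.
          (\<forall>i j. 2 * ricci G i j x - 1/2 * H_squared G K i j x
                 = lam * G [i, j] x - lie_derivative Y G [i, j] x) \<and>
          (\<forall>i j k. hodge_laplacian G K [i, j, k] x
                 = lam * K [i, j, k] x - lie_derivative Y K [i, j, k] x)))"

end

(*
  The soliton is the round cylinder: g is the metric induced from the Euclidean space R^3 x R,
  H is its volume form, X = z d/dz with z the coordinate of the R-factor, and lambda = 1. With
  s = dz one has Ric = g - s^2, H^2 = 2 g and L_X g = 2 s^2, which gives the first equation; H is
  parallel, hence harmonic, and div X = 1 gives L_X H = H.

  In an arbitrary chart psi all of this follows from the completeness relation of the frame
  e_i = d_i psi together with the unit normal N = (n, 0), the projection of psi to the sphere:
  the second fundamental form is -d_i N . e_j, so that the curvature is given by Gauss' equation.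
*)

theory Submission
  imports Defs
begin

section \<open>Directional derivatives\<close>

text \<open>Origin of the constants: on the unit S^2 times R put H = c vol and X = mu z d/dz. The
  second equation becomes 0 = lambda - mu; the first becomes 2 - c^2 = lambda along the sphere and -
  c^2 = lambda - 2 mu along the line. This forces mu = lambda = c^2 = 1. The equations are required
  in every local parametrization, and computing in one convenient chart would call for the
  tensoriality of every operator involved. The extrinsic computation avoids this: the inverse metric
  is absorbed into the dual frame \<open>E\<close>, the Christoffel symbols become
  \<open>E k x \<bullet> pderiv_dir i (e j) x\<close>, and their derivatives are found by splitting
  the derivative of \<open>E\<close> into tangential and normal parts. In the Ricci tensor the third
  derivatives of \<open>\<psi>\<close> cancel by symmetry, the tangential parts cancel the quadratic
  Christoffel terms, and only the normal parts survive. For the volume form it is the normal parts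
  that drop out, and the tangential ones match the Christoffel or Lie derivative
  corrections.\<close>

lemma pderiv_dirI:
  "(f has_derivative f') (at x) \<Longrightarrow> pderiv_dir i f x = f' (axis i 1)"
  unfolding pderiv_dir_def by (drule frechet_derivative_at) simp

text \<open>Identities in a chart hold only on its domain; this is what allows them to be
  differentiated there.\<close>

lemma pderiv_dir_cong_open:
  assumes "open V" "x \<in> V" "f differentiable at x" "\<And>y. y \<in> V \<Longrightarrow> f y = g y"
  shows "pderiv_dir i g x = pderiv_dir i f x"
  unfolding pderiv_dir_def
  using frechet_derivative_transform_within_open[OF assms(3,1,2), of g] assms(4) by simp

lemma differentiable_cong_open:
  assumes "open V" "x \<in> V" "f differentiable at x" "\<And>y. y \<in> V \<Longrightarrow> f y = g y"
  shows "g differentiable at x"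
  using assms(3) has_derivative_transform_within_open[OF _ assms(1,2), of f _ UNIV g] assms(4)
  unfolding differentiable_def by blast

lemma pderiv_dir_const [simp]: "pderiv_dir i (\<lambda>x. c) x = 0"
  by (simp add: pderiv_dir_def)

lemma pderiv_dir_add:
  assumes "f differentiable at x" "g differentiable at x"
  shows "pderiv_dir i (\<lambda>y. f y + g y) x = pderiv_dir i f x + pderiv_dir i g x"
  using pderiv_dirI[OF has_derivative_add[OF assms[unfolded frechet_derivative_works]]]
  by (simp add: pderiv_dir_def)

lemma pderiv_dir_sum:
  assumes "\<And>a. a \<in> S \<Longrightarrow> f a differentiable at x"
  shows "pderiv_dir i (\<lambda>y. \<Sum>a\<in>S. f a y) x = (\<Sum>a\<in>S. pderiv_dir i (f a) x)"
proof -
  have "((\<lambda>y. \<Sum>a\<in>S. f a y) has_derivative (\<lambda>h. \<Sum>a\<in>S. frechet_derivative (f a) (at x) h)) (at x)"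
    by (rule has_derivative_sum) (use assms in \<open>simp add: frechet_derivative_works[symmetric]\<close>)
  from pderiv_dirI[OF this] show ?thesis
    by (simp add: pderiv_dir_def)
qed

lemma (in bounded_linear) pderiv_dir_linear:
  assumes "g differentiable at x"
  shows "pderiv_dir i (\<lambda>y. f (g y)) x = f (pderiv_dir i g x)"
  using pderiv_dirI[OF has_derivative[OF assms[unfolded frechet_derivative_works]]]
  by (simp add: pderiv_dir_def)

lemma (in bounded_bilinear) differentiable_prod:
  assumes "f differentiable at x" "g differentiable at x"
  shows "(\<lambda>y. prod (f y) (g y)) differentiable at x"
  using FDERIV assms unfolding differentiable_def by blast

lemma (in bounded_bilinear) pderiv_dir_prod:
  assumes "f differentiable at x" "g differentiable at x"
  shows "pderiv_dir i (\<lambda>y. prod (f y) (g y)) x =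
    prod (f x) (pderiv_dir i g x) + prod (pderiv_dir i f x) (g x)"
  using pderiv_dirI[OF FDERIV[OF assms[unfolded frechet_derivative_works]]]
  by (simp add: pderiv_dir_def)

lemmas pderiv_dir_inner = bounded_bilinear.pderiv_dir_prod[OF bounded_bilinear_inner]
lemmas pderiv_dir_mult = bounded_bilinear.pderiv_dir_prod[OF bounded_bilinear_mult]
lemmas pderiv_dir_scaleR = bounded_bilinear.pderiv_dir_prod[OF bounded_bilinear_scaleR]

lemma frechet_derivative_expand:
  fixes f :: "real^'n::finite \<Rightarrow> 'b::real_normed_vector"
  assumes "f differentiable at x"
  shows "frechet_derivative f (at x) h = (\<Sum>i\<in>UNIV. h $ i *\<^sub>R pderiv_dir i f x)"
proof -
  have lin: "linear (frechet_derivative f (at x))"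
    by (rule linear_frechet_derivative[OF assms])
  have "h = (\<Sum>i\<in>UNIV. h $ i *\<^sub>R axis i 1)"
    by (simp add: basis_expansion[of h, unfolded scalar_mult_eq_scaleR])
  then have "frechet_derivative f (at x) h = frechet_derivative f (at x) (\<Sum>i\<in>UNIV. h $ i *\<^sub>R axis i 1)"
    by simp
  then show ?thesis
    by (simp add: linear_sum[OF lin] linear_scale[OF lin] pderiv_dir_def)
qed

subsection \<open>Symmetry of second derivatives\<close>

text \<open>By the mean value theorem the second difference of \<open>f\<close> in the directions \<open>i\<close> and \<open>j\<close>, which is
  symmetric in them, is $h^2 \partial_j\partial_i f + o(h^2)$.\<close>

lemma second_difference_tendsto:
  fixes f :: "real^'n::finite \<Rightarrow> real"
  assumes V: "open V" "x \<in> V" and f: "\<And>y. y \<in> V \<Longrightarrow> f differentiable at y"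
    and fi: "pderiv_dir i f differentiable at x"
  shows "((\<lambda>h. (f (x + h *\<^sub>R axis i 1 + h *\<^sub>R axis j 1) - f (x + h *\<^sub>R axis i 1)
      - f (x + h *\<^sub>R axis j 1) + f x) / h\<^sup>2) \<longlongrightarrow> pderiv_dir j (pderiv_dir i f) x) (at_right 0)"
    (is "(?q \<longlongrightarrow> ?l) _")
proof (rule tendstoI)
  fix e :: real
  assume e: "0 < e"
  define L where "L = frechet_derivative (pderiv_dir i f) (at x)"
  have L: "(pderiv_dir i f has_derivative L) (at x)"
    using fi by (simp add: L_def frechet_derivative_works[symmetric])
  have lin: "linear L"
    using L by (rule has_derivative_linear)
  obtain r where r: "0 < r" "ball x r \<subseteq> V"
    using V openE by blast
  from L obtain d where d: "0 < d"
    and dL: "\<And>y. norm (y - x) < d \<Longrightarrow>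
      norm (pderiv_dir i f y - pderiv_dir i f x - L (y - x)) \<le> (e/6) * norm (y - x)"
    unfolding has_derivative_at_alt using e by (auto dest: spec[of _ "e/6"])
  \<comment> \<open>All displacements below have norm at most 2h, so this bound on \<open>h\<close>
    keeps them inside both the ball in \<open>V\<close> and the range of \<open>dL\<close>. The
    tolerance e/6 is used for displacements of norm at most 2h and h, which adds up to e/2 *
    h.\<close>
  have "dist (?q h) ?l < e" if h: "0 < h" "h < min r d / 2" for h
  proof -
    \<comment> \<open>The increment of \<open>g\<close> from 0 to \<open>h\<close> is the second
      difference, so the mean value theorem for \<open>g\<close> leaves a difference of two values
      of \<open>pderiv_dir i f\<close>.\<close>
    define g where "g t = f (x + t *\<^sub>R axis i 1 + h *\<^sub>R axis j 1) - f (x + t *\<^sub>R axis i 1)" for t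
    have n1: "norm (t *\<^sub>R axis i (1::real)) \<le> h" if "0 \<le> t" "t \<le> h" for t
      using that by simp
    have n2: "norm (t *\<^sub>R axis i (1::real) + h *\<^sub>R axis j 1) \<le> 2 * h" if "0 \<le> t" "t \<le> h" for t
      using norm_triangle_le[of "t *\<^sub>R axis i (1::real)" "h *\<^sub>R axis j 1" "2*h"] that h by simp
    have inV: "x + t *\<^sub>R axis i 1 \<in> V" "x + t *\<^sub>R axis i 1 + h *\<^sub>R axis j 1 \<in> V"
      if "0 \<le> t" "t \<le> h" for t
    proof -
      have ball: "x + y \<in> ball x r" if "norm y < r" for y
        using that by (simp add: dist_norm)
      have "x + t *\<^sub>R axis i 1 \<in> ball x r"
        by (rule ball) (use n1[OF that] h in linarith)
      moreover have "x + (t *\<^sub>R axis i 1 + h *\<^sub>R axis j 1) \<in> ball x r"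
        by (rule ball) (use n2[OF that] h in linarith)
      ultimately show "x + t *\<^sub>R axis i 1 \<in> V" "x + t *\<^sub>R axis i 1 + h *\<^sub>R axis j 1 \<in> V"
        using r by (auto simp: add.assoc)
    qed
    have line: "((\<lambda>t. f (c + t *\<^sub>R axis i 1)) has_real_derivative pderiv_dir i f (c + t *\<^sub>R axis i 1)) (at t)"
      if "c + t *\<^sub>R axis i 1 \<in> V" for c t
    proof -
      let ?F = "frechet_derivative f (at (c + t *\<^sub>R axis i 1))"
      have F: "(f has_derivative ?F) (at (c + t *\<^sub>R axis i 1))"
        using f[OF that] by (simp add: frechet_derivative_works[symmetric])
      have "((\<lambda>t. c + t *\<^sub>R axis i 1) has_derivative (\<lambda>s. s *\<^sub>R axis i 1)) (at t)"
        by (auto intro!: derivative_eq_intros)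
      from has_derivative_compose[OF this F]
      have "((\<lambda>t. f (c + t *\<^sub>R axis i 1)) has_derivative (\<lambda>s. ?F (s *\<^sub>R axis i 1))) (at t)" .
      moreover have "?F (s *\<^sub>R axis i 1) = pderiv_dir i f (c + t *\<^sub>R axis i 1) * s" for s
        using linear_scale[OF has_derivative_linear[OF F]] by (simp add: pderiv_dir_def)
      ultimately show ?thesis
        by (simp add: has_field_derivative_def)
    qed
    have "(g has_real_derivative pderiv_dir i f (x + t *\<^sub>R axis i 1 + h *\<^sub>R axis j 1)
        - pderiv_dir i f (x + t *\<^sub>R axis i 1)) (at t)" if t: "0 \<le> t" "t \<le> h" for t
    proof -
      have "((\<lambda>t. f (x + h *\<^sub>R axis j 1 + t *\<^sub>R axis i 1)) has_real_derivative
        pderiv_dir i f (x + h *\<^sub>R axis j 1 + t *\<^sub>R axis i 1)) (at t)"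
        using inV(2)[OF t] by (intro line) (simp add: add_ac)
      from DERIV_diff[OF this line[OF inV(1)[OF t]]] show ?thesis
        unfolding g_def[abs_def] by (simp add: add_ac)
    qed
    from MVT2[OF h(1) this] obtain t where t: "0 < t" "t < h"
      and g: "g h - g 0 = h * (pderiv_dir i f (x + t *\<^sub>R axis i 1 + h *\<^sub>R axis j 1)
        - pderiv_dir i f (x + t *\<^sub>R axis i 1))"
      by auto
    define p where "p = t *\<^sub>R axis i (1::real)"
    define q where "q = t *\<^sub>R axis i (1::real) + h *\<^sub>R axis j 1"
    have "\<bar>pderiv_dir i f (x + q) - pderiv_dir i f x - L q\<bar> \<le> e/6 * (2 * h)"
    proof -
      have n: "norm q \<le> 2 * h" using n2[of t] t by (simp add: q_def)
      then have "\<bar>pderiv_dir i f (x + q) - pderiv_dir i f x - L q\<bar> \<le> e/6 * norm q"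
        using dL[of "x + q"] h by simp
      also have "\<dots> \<le> e/6 * (2 * h)"
        using n e by (intro mult_left_mono) simp_all
      finally show ?thesis .
    qed
    moreover have "\<bar>pderiv_dir i f (x + p) - pderiv_dir i f x - L p\<bar> \<le> e/6 * h"
    proof -
      have n: "norm p \<le> h" using n1[of t] t by (simp add: p_def)
      then have "\<bar>pderiv_dir i f (x + p) - pderiv_dir i f x - L p\<bar> \<le> e/6 * norm p"
        using dL[of "x + p"] h by simp
      also have "\<dots> \<le> e/6 * h"
        using n e by (intro mult_left_mono) simp_all
      finally show ?thesis .
    qed
    moreover have "L q - L p = h * ?l"
    proof -
      have "L q - L p = L (h *\<^sub>R axis j 1)"
        by (simp add: linear_diff[OF lin, symmetric] p_def q_def)
      then show ?thesis
        by (simp add: linear_scale[OF lin]) (simp add: L_def pderiv_dir_def)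
    qed
    ultimately have "\<bar>(pderiv_dir i f (x + q) - pderiv_dir i f (x + p)) - h * ?l\<bar> \<le> e/2 * h"
      by linarith
    moreover have "?q h = (pderiv_dir i f (x + q) - pderiv_dir i f (x + p)) / h"
    proof -
      have "f (x + h *\<^sub>R axis i 1 + h *\<^sub>R axis j 1) - f (x + h *\<^sub>R axis i 1)
        - f (x + h *\<^sub>R axis j 1) + f x = g h - g 0"
        by (simp add: g_def)
      then show ?thesis
        using g h by (simp add: p_def q_def power2_eq_square add.assoc)
    qed
    moreover have "\<bar>a / h - ?l\<bar> = \<bar>a - h * ?l\<bar> / h" for a
      using h by (simp add: field_simps abs_if)
    ultimately have "dist (?q h) ?l \<le> e/2"
      using h by (simp add: dist_real_def divide_le_eq)
    then show ?thesis
      using e by simp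
  qed
  moreover have "\<forall>\<^sub>F h in at_right 0. 0 < h \<and> h < min r d / 2"
    using r(1) d by (auto simp: eventually_at_right_field intro!: exI[of _ "min r d / 2"])
  ultimately show "\<forall>\<^sub>F h in at_right 0. dist (?q h) ?l < e"
    by (auto elim: eventually_mono)
qed

lemma pderiv_dir_commute_real:
  fixes f :: "real^'n::finite \<Rightarrow> real"
  assumes "open V" "x \<in> V" "\<And>y. y \<in> V \<Longrightarrow> f differentiable at y"
    and "pderiv_dir i f differentiable at x" "pderiv_dir j f differentiable at x"
  shows "pderiv_dir i (pderiv_dir j f) x = pderiv_dir j (pderiv_dir i f) x"
proof -
  note 1 = second_difference_tendsto[OF assms(1,2) _ assms(5), of i]
  note 2 = second_difference_tendsto[OF assms(1,2) _ assms(4), of j]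
  have "(\<lambda>h. (f (x + h *\<^sub>R axis i 1 + h *\<^sub>R axis j 1) - f (x + h *\<^sub>R axis i 1)
      - f (x + h *\<^sub>R axis j 1) + f x) / h\<^sup>2) =
    (\<lambda>h. (f (x + h *\<^sub>R axis j 1 + h *\<^sub>R axis i 1) - f (x + h *\<^sub>R axis j 1)
      - f (x + h *\<^sub>R axis i 1) + f x) / h\<^sup>2)"
    by (simp add: add_ac diff_diff_eq)
  from tendsto_unique[OF trivial_limit_at_right_real 1[unfolded this[symmetric]] 2] assms(3)
  show ?thesis by blast
qed

lemma pderiv_dir_commute:
  fixes f :: "real^'n::finite \<Rightarrow> 'b::euclidean_space"
  assumes V: "open V" "x \<in> V" and f: "\<And>y. y \<in> V \<Longrightarrow> f differentiable at y"
    and fi: "\<And>y i. y \<in> V \<Longrightarrow> pderiv_dir i f differentiable at y"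
  shows "pderiv_dir i (pderiv_dir j f) x = pderiv_dir j (pderiv_dir i f) x"
proof (rule euclidean_eqI)
  fix b :: 'b
  assume "b \<in> Basis"
  interpret b: bounded_linear "\<lambda>y. y \<bullet> b"
    by (rule bounded_linear_inner_left)
  have 1: "pderiv_dir k (\<lambda>y. f y \<bullet> b) y = pderiv_dir k f y \<bullet> b" if "y \<in> V" for k y
    by (rule b.pderiv_dir_linear[OF f[OF that]])
  have 2: "(\<lambda>y. pderiv_dir k f y \<bullet> b) differentiable at x" for k
    using fi[OF V(2)] b.has_derivative unfolding differentiable_def by blast
  have 3: "pderiv_dir k (\<lambda>y. f y \<bullet> b) differentiable at x" for k
    by (rule differentiable_cong_open[OF V 2]) (simp add: 1)
  have 4: "pderiv_dir l (pderiv_dir k (\<lambda>y. f y \<bullet> b)) x = pderiv_dir l (pderiv_dir k f) x \<bullet> b" for k l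
    using pderiv_dir_cong_open[OF V 2, of k "pderiv_dir k (\<lambda>y. f y \<bullet> b)" l] 1
      b.pderiv_dir_linear[OF fi[OF V(2)]] by simp
  have "pderiv_dir i (pderiv_dir j (\<lambda>y. f y \<bullet> b)) x = pderiv_dir j (pderiv_dir i (\<lambda>y. f y \<bullet> b)) x"
    by (rule pderiv_dir_commute_real[OF V _ 3 3]) (use f in \<open>auto intro!: derivative_intros\<close>)
  then show "pderiv_dir i (pderiv_dir j f) x \<bullet> b = pderiv_dir j (pderiv_dir i f) x \<bullet> b"
    by (simp add: 4)
qed

section \<open>Closure properties of smooth maps\<close>

lemma C_on_Suc_imp: "C_on (Suc k) V f \<Longrightarrow> C_on k V f"
  by (induction k arbitrary: f) (auto intro: differentiable_imp_continuous_on)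

text \<open>The recursion in \<open>C_on\<close> is about the function
  \<open>pderiv_dir i f\<close>, whereas the rules of differentiation give its values on
  \<open>V\<close> only. This lemma closes the gap in each of the inductions below.\<close>

lemma C_on_cong:
  assumes V: "open V"
  shows "C_on k V f \<Longrightarrow> (\<And>x. x \<in> V \<Longrightarrow> f x = g x) \<Longrightarrow> C_on k V g"
proof (induction k arbitrary: f g)
  case 0
  then show ?case
    using continuous_on_cong by (metis C_on.simps(1))
next
  case (Suc k)
  have f: "f differentiable at x" if "x \<in> V" for x
    using Suc.prems(1) that V by (simp add: differentiable_on_eq_differentiable_at)
  have "g differentiable at x" if "x \<in> V" for x
    using differentiable_cong_open[OF V that f[OF that]] Suc.prems(2) by metis
  moreover have "C_on k V (pderiv_dir i g)" for i
  proof (rule Suc.IH)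
    show "C_on k V (pderiv_dir i f)"
      using Suc.prems(1) by simp
    show "pderiv_dir i f x = pderiv_dir i g x" if "x \<in> V" for x
      using pderiv_dir_cong_open[OF V that f[OF that]] Suc.prems(2) by metis
  qed
  ultimately show ?case
    using V by (simp add: differentiable_on_eq_differentiable_at)
qed

lemma C_on_Suc_iff:
  assumes "open V"
  shows "C_on (Suc k) V f \<longleftrightarrow>
    (\<forall>x\<in>V. f differentiable at x) \<and> (\<forall>i. C_on k V (pderiv_dir i f))"
  using assms by (simp add: differentiable_on_eq_differentiable_at)

lemma C_on_const: "C_on k V (\<lambda>x. c)"
proof (induction k arbitrary: c)
  case (Suc k)
  have "pderiv_dir i (\<lambda>x. c) = (\<lambda>x. 0)" for i :: 'a
    by (rule ext) simp
  then show ?case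
    using Suc by (simp add: differentiable_on_const)
qed simp

lemma C_on_add:
  assumes V: "open V"
  shows "C_on k V f \<Longrightarrow> C_on k V g \<Longrightarrow> C_on k V (\<lambda>x. f x + g x)"
proof (induction k arbitrary: f g)
  case 0
  then show ?case by (simp add: continuous_on_add)
next
  case (Suc k)
  have "C_on k V (pderiv_dir i (\<lambda>x. f x + g x))" for i
    by (rule C_on_cong[OF V, where f="\<lambda>x. pderiv_dir i f x + pderiv_dir i g x"])
      (use Suc in \<open>auto simp: C_on_Suc_iff[OF V] pderiv_dir_add simp del: C_on.simps\<close>)
  then show ?case
    using Suc.prems unfolding C_on_Suc_iff[OF V] by auto
qed

lemma C_on_linear:
  assumes V: "open V" and L: "bounded_linear L"
  shows "C_on k V f \<Longrightarrow> C_on k V (\<lambda>x. L (f x))"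
proof (induction k arbitrary: f)
  case 0
  then show ?case by (simp add: bounded_linear.continuous_on[OF L])
next
  case (Suc k)
  have "C_on k V (pderiv_dir i (\<lambda>x. L (f x)))" for i
    by (rule C_on_cong[OF V, where f="\<lambda>x. L (pderiv_dir i f x)"])
      (use Suc in \<open>auto simp: C_on_Suc_iff[OF V] bounded_linear.pderiv_dir_linear[OF L] simp del: C_on.simps\<close>)
  moreover have "(\<lambda>x. L (f x)) differentiable at x" if "x \<in> V" for x
    using Suc.prems that bounded_linear.has_derivative[OF L] unfolding C_on_Suc_iff[OF V]
    by (metis differentiable_def)
  ultimately show ?case
    unfolding C_on_Suc_iff[OF V] by auto
qed

text \<open>The induction works because the product rule returns products of the same kind, with one
  factor differentiated; \<open>C_on_Suc_imp\<close> lowers the order of the other one. Inner,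
  scalar and cross products are all instances.\<close>

lemma C_on_bilinear:
  assumes V: "open V" and B: "bounded_bilinear B"
  shows "C_on k V f \<Longrightarrow> C_on k V g \<Longrightarrow> C_on k V (\<lambda>x. B (f x) (g x))"
proof (induction k arbitrary: f g)
  case 0
  then show ?case by (simp add: bounded_bilinear.continuous_on[OF B])
next
  case (Suc k)
  have "C_on k V (pderiv_dir i (\<lambda>x. B (f x) (g x)))" for i
  proof (rule C_on_cong[OF V])
    show "C_on k V (\<lambda>x. B (f x) (pderiv_dir i g x) + B (pderiv_dir i f x) (g x))"
      by (intro C_on_add[OF V] Suc.IH)
        (use Suc.prems in \<open>auto intro: C_on_Suc_imp simp: C_on_Suc_iff[OF V] simp del: C_on.simps\<close>)
  qed (use Suc.prems in \<open>auto simp: C_on_Suc_iff[OF V] bounded_bilinear.pderiv_dir_prod[OF B] simp del: C_on.simps\<close>)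
  then show ?case
    using Suc.prems unfolding C_on_Suc_iff[OF V]
    by (auto intro!: bounded_bilinear.differentiable_prod[OF B])
qed

lemma smooth_map_on_linear:
  "open V \<Longrightarrow> bounded_linear L \<Longrightarrow> smooth_map_on V f \<Longrightarrow> smooth_map_on V (\<lambda>x. L (f x))"
  unfolding smooth_map_on_def by (auto intro: C_on_linear)

lemma smooth_map_on_bilinear:
  "open V \<Longrightarrow> bounded_bilinear B \<Longrightarrow> smooth_map_on V f \<Longrightarrow> smooth_map_on V g \<Longrightarrow>
    smooth_map_on V (\<lambda>x. B (f x) (g x))"
  unfolding smooth_map_on_def by (auto intro: C_on_bilinear)

lemma smooth_map_on_add:
  "open V \<Longrightarrow> smooth_map_on V f \<Longrightarrow> smooth_map_on V g \<Longrightarrow> smooth_map_on V (\<lambda>x. f x + g x)"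
  unfolding smooth_map_on_def by (auto intro: C_on_add)

lemma smooth_map_on_pderiv_dir: "smooth_map_on V f \<Longrightarrow> smooth_map_on V (pderiv_dir i f)"
  unfolding smooth_map_on_def by (metis C_on.simps(2))

lemma smooth_map_on_differentiable:
  "smooth_map_on V f \<Longrightarrow> open V \<Longrightarrow> x \<in> V \<Longrightarrow> f differentiable at x"
  unfolding smooth_map_on_def by (metis C_on_Suc_iff)

lemma smooth_map_on_continuous: "smooth_map_on V f \<Longrightarrow> continuous_on V f"
  unfolding smooth_map_on_def by (metis C_on.simps(1))

section \<open>A global parametrization of the cylinder\<close>

lemma C_on_ident: "C_on k V (\<lambda>x. x)"
proof (cases k)
  case (Suc l)
  have "pderiv_dir i (\<lambda>x::real^'a. x) = (\<lambda>x. axis i 1)" for i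
    by (rule ext) (simp add: pderiv_dir_def)
  then show ?thesis
    using Suc by (simp add: differentiable_on_ident C_on_const)
qed (simp add: continuous_on_id)

lemma C_on_mult:
  fixes f g :: "real^'n::finite \<Rightarrow> real"
  shows "open V \<Longrightarrow> C_on k V f \<Longrightarrow> C_on k V g \<Longrightarrow> C_on k V (\<lambda>x. f x * g x)"
  by (rule C_on_bilinear[OF _ bounded_bilinear_mult])

lemma C_on_component: "open V \<Longrightarrow> C_on k V (\<lambda>x. x $ i)"
  by (rule C_on_linear[OF _ bounded_linear_vec_nth C_on_ident])

lemma open_Compl_zero: "open (- {0 :: real^'n::finite})"
  by (simp add: open_Compl)

lemma has_derivative_inverse_norm:
  fixes x :: "real^'n::finite"
  assumes "x \<noteq> 0"
  shows "((\<lambda>x. inverse (norm x)) has_derivative (\<lambda>h. - (x \<bullet> h) * inverse (norm x) ^ 3)) (at x)"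
proof -
  have "((\<lambda>x. inverse (norm x)) has_derivative
      (\<lambda>h. - (inverse (norm x) * (sgn x \<bullet> h) * inverse (norm x)))) (at x)"
    using assms has_derivative_norm[OF assms]
    by (intro Deriv.has_derivative_inverse) (simp_all add: inner_commute)
  then show ?thesis
    by (rule has_derivative_eq_rhs) (auto simp: sgn_div_norm power3_eq_cube)
qed

text \<open>The i-th partial derivative is - x_i times the cube of the function itself, so the
  induction hypothesis applies to it.\<close>

lemma C_on_inverse_norm: "C_on k (- {0 :: real^'n::finite}) (\<lambda>x. inverse (norm x))"
proof (induction k)
  case 0
  show ?case by (auto intro!: continuous_intros)
next
  case (Suc k)
  have "C_on k (- {0 :: real^'n}) (pderiv_dir i (\<lambda>x. inverse (norm x)))" for i
  proof (rule C_on_cong[OF open_Compl_zero])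
    show "C_on k (- {0 :: real^'n}) (\<lambda>x. (-1 * x $ i) * (inverse (norm x) * (inverse (norm x) * inverse (norm x))))"
      by (intro C_on_mult C_on_const C_on_component Suc.IH open_Compl_zero)
  qed (simp add: pderiv_dirI[OF has_derivative_inverse_norm] inner_axis power3_eq_cube)
  then show ?case
    unfolding C_on_Suc_iff[OF open_Compl_zero]
    using has_derivative_inverse_norm differentiable_def by blast
qed

lemma has_derivative_ln_norm:
  fixes x :: "real^'n::finite"
  assumes "x \<noteq> 0"
  shows "((\<lambda>x. ln (norm x)) has_derivative (\<lambda>h. (x \<bullet> h) * inverse (norm x) ^ 2)) (at x)"
proof -
  have "((\<lambda>x. ln (norm x)) has_derivative (\<lambda>h. (sgn x \<bullet> h) * inverse (norm x))) (at x)"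
    using assms has_derivative_norm[OF assms]
    by (auto intro!: derivative_eq_intros simp: inner_commute)
  then show ?thesis
    by (rule has_derivative_eq_rhs) (auto simp: sgn_div_norm power2_eq_square)
qed

lemma C_on_ln_norm: "C_on k (- {0 :: real^'n::finite}) (\<lambda>x. ln (norm x))"
proof (cases k)
  case 0
  then show ?thesis by (auto intro!: continuous_intros)
next
  case (Suc l)
  have "C_on l (- {0 :: real^'n}) (pderiv_dir i (\<lambda>x. ln (norm x)))" for i
  proof (rule C_on_cong[OF open_Compl_zero])
    show "C_on l (- {0 :: real^'n}) (\<lambda>x. x $ i * (inverse (norm x) * inverse (norm x)))"
      by (intro C_on_mult C_on_component C_on_inverse_norm open_Compl_zero)
  qed (simp add: pderiv_dirI[OF has_derivative_ln_norm] inner_axis power2_eq_square)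
  then show ?thesis
    unfolding Suc C_on_Suc_iff[OF open_Compl_zero]
    using has_derivative_ln_norm differentiable_def by blast
qed

text \<open>Logarithmic polar coordinates, with inverse (n, z) \<mapsto> exp z n. They identify
  punctured space with the whole cylinder, so that no atlas of the sphere is required.\<close>

definition polar :: "real^'n::finite \<Rightarrow> (real^'n) \<times> real"
  where "polar x = (inverse (norm x) *\<^sub>R x, ln (norm x))"

lemma smooth_map_on_polar: "smooth_map_on (- {0 :: real^'n::finite}) polar"
proof -
  have fst: "bounded_linear (\<lambda>v :: real^'n. (v, 0::real))"
    and snd: "bounded_linear (\<lambda>t :: real. (0 :: real^'n, t))"
    by (rule bounded_linear_Pair[OF bounded_linear_ident bounded_linear_zero]
      bounded_linear_Pair[OF bounded_linear_zero bounded_linear_ident])+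
  have "C_on k (- {0 :: real^'n})
      (\<lambda>x. (\<lambda>v. (v, 0)) (inverse (norm x) *\<^sub>R x) + (\<lambda>t. (0, t)) (ln (norm x)))" for k
    by (intro C_on_add C_on_linear[OF _ fst] C_on_linear[OF _ snd] C_on_ln_norm
      C_on_bilinear[OF _ bounded_bilinear_scaleR] C_on_inverse_norm C_on_ident open_Compl_zero)
  then show ?thesis
    unfolding smooth_map_on_def polar_def[abs_def] by simp
qed

lemma polar_image: "polar ` (- {0 :: real^'n::finite}) = sphere 0 1 \<times> UNIV"
proof
  show "polar ` (- {0 :: real^'n}) \<subseteq> sphere 0 1 \<times> UNIV"
    by (auto simp: polar_def)
  show "sphere 0 1 \<times> UNIV \<subseteq> polar ` (- {0 :: real^'n})"
  proof clarify
    fix n :: "real^'n" and z :: real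
    assume "n \<in> sphere 0 1"
    then have "polar (exp z *\<^sub>R n) = (n, z)" "exp z *\<^sub>R n \<noteq> 0"
      by (auto simp: polar_def)
    then show "(n, z) \<in> polar ` (- {0})"
      by (metis ComplI imageI singletonD)
  qed
qed

lemma polar_inverse: "x \<noteq> 0 \<Longrightarrow> exp (snd (polar x)) *\<^sub>R fst (polar x) = x"
  by (simp add: polar_def)

lemma local_parametrization_polar:
  "local_parametrization (sphere 0 1 \<times> UNIV) (- {0 :: real^'n::finite}) polar"
  unfolding local_parametrization_def
proof (intro conjI ballI)
  let ?\<phi> = "\<lambda>q :: (real^'n) \<times> real. exp (snd q) *\<^sub>R fst q"
  fix x :: "real^'n"
  assume x: "x \<in> - {0}"
  let ?D = "frechet_derivative polar (at x)"
  have "(polar has_derivative ?D) (at x)"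
    using smooth_map_on_differentiable[OF smooth_map_on_polar open_Compl_zero x]
    by (simp add: frechet_derivative_works[symmetric])
  \<comment> \<open>\<open>F\<close> is the derivative of the inverse map \<open>?\<phi>\<close>; by
    the chain rule it is a left inverse of \<open>?D\<close>, which is therefore injective.\<close>
  moreover define F where "F h = exp (snd (polar x)) *\<^sub>R fst h +
    (snd h * exp (snd (polar x))) *\<^sub>R fst (polar x)" for h
  have "(?\<phi> has_derivative F) (at (polar x))"
    unfolding F_def[abs_def] by (rule derivative_eq_intros refl)+
  ultimately have "((\<lambda>y. ?\<phi> (polar y)) has_derivative (\<lambda>h. F (?D h))) (at x)"
    by (rule has_derivative_compose)
  then have "((\<lambda>y. y) has_derivative (\<lambda>h. F (?D h))) (at x)"
    by (rule has_derivative_transform_within_open[OF _ open_Compl_zero x])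
      (simp add: polar_inverse)
  then have "(\<lambda>h. F (?D h)) = (\<lambda>h. h)"
    using has_derivative_unique has_derivative_ident by blast
  then show "inj ?D"
    by (metis injI)
next
  have "homeomorphism (- {0}) (polar ` (- {0})) polar (\<lambda>q. exp (snd q) *\<^sub>R fst q)"
    unfolding homeomorphism_def
  proof (intro conjI ballI)
    show "continuous_on (- {0}) polar"
      by (rule smooth_map_on_continuous[OF smooth_map_on_polar])
    show "continuous_on (polar ` (- {0})) (\<lambda>q. exp (snd q) *\<^sub>R fst q)"
      by (intro continuous_intros)
    show "(\<lambda>q. exp (snd q) *\<^sub>R fst q) ` polar ` (- {0}) = - {0}"
      by (simp add: image_image polar_inverse)
    show "polar (exp (snd q) *\<^sub>R fst q) = q" if "q \<in> polar ` (- {0})" for q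
      using that by (elim imageE) (simp add: polar_inverse)
  qed (simp_all add: polar_inverse)
  then show "\<exists>\<phi>. homeomorphism (- {0}) (polar ` (- {0})) polar \<phi>"
    by blast
next
  show "openin (top_of_set (sphere 0 1 \<times> UNIV)) (polar ` (- {0}))"
    by (simp add: polar_image)
qed (simp_all add: smooth_map_on_polar open_Compl_zero)

lemma smooth_submanifold_cylinder:
  "smooth_submanifold TYPE('n::finite) (sphere (0 :: real^'n) 1 \<times> (UNIV :: real set))"
  unfolding smooth_submanifold_def using local_parametrization_polar polar_image by metis

section \<open>The structure on the cylinder\<close>

abbreviation cylinder :: "((real^3) \<times> real) set"
  where "cylinder \<equiv> sphere 0 1 \<times> UNIV"

text \<open>\<open>frame_vol n u v w\<close> is the determinant of \<open>(n, 0), u, v, w\<close>, up to orientation.\<close>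

definition frame_vol :: "real^3 \<Rightarrow> (real^3) \<times> real \<Rightarrow> (real^3) \<times> real \<Rightarrow> (real^3) \<times> real \<Rightarrow> real"
  where "frame_vol n u v w = snd u * (n \<bullet> cross3 (fst v) (fst w))
    + snd v * (n \<bullet> cross3 (fst w) (fst u)) + snd w * (n \<bullet> cross3 (fst u) (fst v))"

text \<open>Up to sign the generalized cross product of (n, 0), u, v in R^4: the vector that
  represents the linear form \<open>frame_vol n u v\<close>. It turns contractions of the volume
  form into inner products.\<close>

definition frame_cross :: "real^3 \<Rightarrow> (real^3) \<times> real \<Rightarrow> (real^3) \<times> real \<Rightarrow> (real^3) \<times> real"
  where "frame_cross n u v =
    (cross3 n (snd u *\<^sub>R fst v - snd v *\<^sub>R fst u), n \<bullet> cross3 (fst u) (fst v))"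

lemma frame_vol_eq_inner: "frame_vol n u v w = frame_cross n u v \<bullet> w"
  by (simp add: frame_vol_def frame_cross_def inner_prod_def cross3_simps)

lemma frame_vol_swap:
  "frame_vol n v u w = - frame_vol n u v w" "frame_vol n u w v = - frame_vol n u v w"
  by (simp_all add: frame_vol_def cross3_simps)

lemma frame_vol_eq_zero [simp]:
  "frame_vol n u u w = 0" "frame_vol n u v v = 0" "frame_vol n u v u = 0"
  by (simp_all add: frame_vol_def cross3_simps)

lemma linear_frame_vol:
  "linear (\<lambda>u. frame_vol n u v w)" "linear (\<lambda>v. frame_vol n u v w)" "linear (\<lambda>w. frame_vol n u v w)"
  by (rule linearI; simp_all add: frame_vol_def cross_add_left cross_add_right cross_mult_left
      cross_mult_right inner_add_right algebra_simps)+

lemmas frame_vol_add = linear_add[OF linear_frame_vol(1)] linear_add[OF linear_frame_vol(2)]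
  linear_add[OF linear_frame_vol(3)]
lemmas frame_vol_diff = linear_diff[OF linear_frame_vol(1)] linear_diff[OF linear_frame_vol(2)]
  linear_diff[OF linear_frame_vol(3)]
lemmas frame_vol_scale = linear_scale[OF linear_frame_vol(1), simplified]
  linear_scale[OF linear_frame_vol(2), simplified] linear_scale[OF linear_frame_vol(3), simplified]
lemmas frame_vol_sum = linear_sum[OF linear_frame_vol(1)] linear_sum[OF linear_frame_vol(2)]
  linear_sum[OF linear_frame_vol(3)]

lemma frame_vol_normal:
  "frame_vol n (n, 0) v w = 0" "frame_vol n u (n, 0) w = 0" "frame_vol n u v (n, 0) = 0"
  by (simp_all add: frame_vol_def dot_cross_self)

text \<open>Lagrange's formula, applied twice: n \<times> (a \<times> b) vanishes because a and b
  are orthogonal to n, and expanding n \<times> (n \<times> (a \<times> b)) = 0 gives the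
  claim.\<close>

lemma cross_tangent:
  assumes "n \<bullet> n = 1" "n \<bullet> a = 0" "n \<bullet> b = 0"
  shows "cross3 a b = (n \<bullet> cross3 a b) *\<^sub>R n"
proof -
  have "cross3 n (cross3 n (cross3 a b)) = (n \<bullet> cross3 a b) *\<^sub>R n - (n \<bullet> n) *\<^sub>R cross3 a b"
    by (rule Lagrange)
  moreover have "cross3 n (cross3 a b) = 0"
    using assms by (simp add: Lagrange)
  ultimately show ?thesis
    using assms by simp
qed

text \<open>This is a determinant of four vectors in the three-dimensional orthogonal complement of
  (n, 0). It disposes of the term in which the normal is differentiated.\<close>

lemma frame_vol_tangent:
  assumes "n \<bullet> n = 1" "n \<bullet> w = 0" "n \<bullet> fst a = 0" "n \<bullet> fst b = 0" "n \<bullet> fst c = 0"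
  shows "frame_vol w a b c = 0"
proof -
  have "w \<bullet> cross3 p q = 0" if "n \<bullet> p = 0" "n \<bullet> q = 0" for p q
    using cross_tangent[OF assms(1) that] assms(2)
    by (metis inner_commute inner_scaleR_right mult_zero_right)
  then show ?thesis
    using assms by (simp add: frame_vol_def)
qed

text \<open>The Binet-Cauchy identity on the tangent space. The second components of
  \<open>frame_cross\<close> give the inner product of the cross products of the spherical parts, by
  \<open>cross_tangent\<close>; in the first components, multiplication by n is an isometry of the
  plane orthogonal to n.\<close>

lemma inner_frame_cross:
  assumes "n \<bullet> n = 1" "n \<bullet> fst u = 0" "n \<bullet> fst v = 0" "n \<bullet> fst u' = 0" "n \<bullet> fst v' = 0"
  shows "frame_cross n u v \<bullet> frame_cross n u' v' = (u \<bullet> u') * (v \<bullet> v') - (u \<bullet> v') * (v \<bullet> u')"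
proof -
  have "(n \<bullet> cross3 (fst u) (fst v)) * (n \<bullet> cross3 (fst u') (fst v'))
      = ((n \<bullet> cross3 (fst u) (fst v)) *\<^sub>R n) \<bullet> ((n \<bullet> cross3 (fst u') (fst v')) *\<^sub>R n)"
    by (simp add: assms(1))
  also have "\<dots> = cross3 (fst u) (fst v) \<bullet> cross3 (fst u') (fst v')"
    by (simp only: cross_tangent[OF assms(1-3), symmetric] cross_tangent[OF assms(1,4,5), symmetric])
  also have "\<dots> = (fst u \<bullet> fst u') * (fst v \<bullet> fst v') - (fst u \<bullet> fst v') * (fst v \<bullet> fst u')"
    by (rule dot_cross)
  finally have 1: "(n \<bullet> cross3 (fst u) (fst v)) * (n \<bullet> cross3 (fst u') (fst v')) = \<dots>" .
  have "frame_cross n u v \<bullet> frame_cross n u' v' =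
      (snd u *\<^sub>R fst v - snd v *\<^sub>R fst u) \<bullet> (snd u' *\<^sub>R fst v' - snd v' *\<^sub>R fst u')
      + (n \<bullet> cross3 (fst u) (fst v)) * (n \<bullet> cross3 (fst u') (fst v'))"
    using assms by (simp add: frame_cross_def inner_prod_def dot_cross inner_diff_left
        inner_diff_right inner_commute)
  also have "\<dots> = (u \<bullet> u') * (v \<bullet> v') - (u \<bullet> v') * (v \<bullet> u')"
    unfolding 1 by (simp add: inner_prod_def inner_diff_left inner_diff_right inner_commute algebra_simps)
  finally show ?thesis .
qed

lemma bounded_bilinear_cross3: "bounded_bilinear cross3"
  using bilinear_cross bilinear_conv_bounded_bilinear by blast

lemma pderiv_dir_fst_snd:
  assumes "u differentiable at x"
  shows "pderiv_dir p (\<lambda>y. fst (u y)) x = fst (pderiv_dir p u x)"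
    and "pderiv_dir p (\<lambda>y. snd (u y)) x = snd (pderiv_dir p u x)"
  using bounded_linear.pderiv_dir_linear[OF bounded_linear_fst assms]
    bounded_linear.pderiv_dir_linear[OF bounded_linear_snd assms] by auto

lemma differentiable_fst_snd:
  assumes "u differentiable at x"
  shows "(\<lambda>y. fst (u y)) differentiable at x" "(\<lambda>y. snd (u y)) differentiable at x"
  using assms has_derivative_fst has_derivative_snd unfolding differentiable_def by blast+

lemma pderiv_dir_triple:
  assumes "n differentiable at x" "a differentiable at x" "b differentiable at x" "s differentiable at x"
  shows "(\<lambda>y. s y * (n y \<bullet> cross3 (a y) (b y))) differentiable at x"
    and "pderiv_dir p (\<lambda>y. s y * (n y \<bullet> cross3 (a y) (b y))) x =
      pderiv_dir p s x * (n x \<bullet> cross3 (a x) (b x)) + s x * (pderiv_dir p n x \<bullet> cross3 (a x) (b x)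
      + n x \<bullet> cross3 (pderiv_dir p a x) (b x) + n x \<bullet> cross3 (a x) (pderiv_dir p b x))"
proof -
  note c = bounded_bilinear.differentiable_prod[OF bounded_bilinear_cross3 assms(2,3)]
  note i = bounded_bilinear.differentiable_prod[OF bounded_bilinear_inner assms(1) c]
  show "(\<lambda>y. s y * (n y \<bullet> cross3 (a y) (b y))) differentiable at x"
    by (rule bounded_bilinear.differentiable_prod[OF bounded_bilinear_mult assms(4) i])
  show "pderiv_dir p (\<lambda>y. s y * (n y \<bullet> cross3 (a y) (b y))) x =
      pderiv_dir p s x * (n x \<bullet> cross3 (a x) (b x)) + s x * (pderiv_dir p n x \<bullet> cross3 (a x) (b x)
      + n x \<bullet> cross3 (pderiv_dir p a x) (b x) + n x \<bullet> cross3 (a x) (pderiv_dir p b x))"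
    by (simp add: pderiv_dir_mult[OF assms(4) i] pderiv_dir_inner[OF assms(1) c]
      bounded_bilinear.pderiv_dir_prod[OF bounded_bilinear_cross3 assms(2,3)] inner_add_right algebra_simps)
qed

lemma pderiv_dir_frame_vol:
  assumes "n differentiable at x" "u differentiable at x" "v differentiable at x" "w differentiable at x"
  shows "(\<lambda>y. frame_vol (n y) (u y) (v y) (w y)) differentiable at x" (is ?d)
    and "pderiv_dir p (\<lambda>y. frame_vol (n y) (u y) (v y) (w y)) x =
      frame_vol (pderiv_dir p n x) (u x) (v x) (w x) + frame_vol (n x) (pderiv_dir p u x) (v x) (w x)
      + frame_vol (n x) (u x) (pderiv_dir p v x) (w x) + frame_vol (n x) (u x) (v x) (pderiv_dir p w x)" (is ?p)
proof -
  note d = differentiable_fst_snd[OF assms(2)] differentiable_fst_snd[OF assms(3)]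
    differentiable_fst_snd[OF assms(4)]
  note t1 = pderiv_dir_triple[OF assms(1) d(3) d(5) d(2)]
  note t2 = pderiv_dir_triple[OF assms(1) d(5) d(1) d(4)]
  note t3 = pderiv_dir_triple[OF assms(1) d(1) d(3) d(6)]
  show ?d
    unfolding frame_vol_def by (intro differentiable_add t1 t2 t3)
  show ?p
    unfolding frame_vol_def pderiv_dir_add[OF differentiable_add[OF t1(1) t2(1)] t3(1)]
      pderiv_dir_add[OF t1(1) t2(1)] t1(2) t2(2) t3(2)
    by (simp add: pderiv_dir_fst_snd assms algebra_simps)
qed

section \<open>The metric, the torsion form and the vector field as global objects\<close>

definition cylinder_metric :: "((real^3) \<times> real) covariant_tensor"
  where "cylinder_metric p vs = vs ! 0 \<bullet> vs ! 1"

definition cylinder_volume :: "((real^3) \<times> real) covariant_tensor"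
  where "cylinder_volume p vs = frame_vol (fst p) (vs ! 0) (vs ! 1) (vs ! 2)"

definition axial_field :: "(real^3) \<times> real \<Rightarrow> (real^3) \<times> real"
  where "axial_field p = (0, snd p)"

lemma components_metric [simp]:
  "components_in \<psi> cylinder_metric [i, j] = (\<lambda>x. pderiv_dir i \<psi> x \<bullet> pderiv_dir j \<psi> x)"
  by (rule ext) (simp add: components_in_def cylinder_metric_def)

lemma components_volume [simp]:
  "components_in \<psi> cylinder_volume [i, j, k] =
    (\<lambda>x. frame_vol (fst (\<psi> x)) (pderiv_dir i \<psi> x) (pderiv_dir j \<psi> x) (pderiv_dir k \<psi> x))"
  by (rule ext) (simp add: components_in_def cylinder_volume_def numeral_2_eq_2)

lemma smooth_map_on_frame_vol:
  assumes V: "open V" and s: "smooth_map_on V n" "smooth_map_on V u" "smooth_map_on V v" "smooth_map_on V w"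
  shows "smooth_map_on V (\<lambda>x. frame_vol (n x) (u x) (v x) (w x))"
  unfolding frame_vol_def
  by (intro smooth_map_on_add[OF V] s
    smooth_map_on_bilinear[OF V bounded_bilinear_mult] smooth_map_on_bilinear[OF V bounded_bilinear_inner]
    smooth_map_on_bilinear[OF V bounded_bilinear_cross3] smooth_map_on_linear[OF V bounded_linear_fst]
    smooth_map_on_linear[OF V bounded_linear_snd])

lemma length_2_conv: "length xs = 2 \<longleftrightarrow> (\<exists>a b. xs = [a, b])"
  by (auto simp: numeral_2_eq_2 length_Suc_conv)

lemma length_3_conv: "length xs = 3 \<longleftrightarrow> (\<exists>a b c. xs = [a, b, c])"
  by (auto simp: numeral_3_eq_3 length_Suc_conv)

lemma tensor_field_metric: "tensor_field TYPE(3) 2 cylinder cylinder_metric"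
  unfolding tensor_field_def
proof (intro conjI ballI allI impI)
  fix V and \<psi> :: "real^3 \<Rightarrow> (real^3) \<times> real" and "is" :: "3 list"
  assume a: "local_parametrization cylinder V \<psi>" and l: "length is = 2"
  then have "open V" "smooth_map_on V \<psi>"
    by (auto simp: local_parametrization_def)
  then show "smooth_map_on V (components_in \<psi> cylinder_metric is)"
    using l by (auto simp: length_2_conv intro!: smooth_map_on_pderiv_dir
      smooth_map_on_bilinear[OF _ bounded_bilinear_inner])
qed (auto simp: cylinder_metric_def length_2_conv inner_simps less_2_cases_iff algebra_simps)

lemma tensor_field_volume: "tensor_field TYPE(3) 3 cylinder cylinder_volume"
  unfolding tensor_field_def
proof (intro conjI ballI allI impI)
  fix V and \<psi> :: "real^3 \<Rightarrow> (real^3) \<times> real" and "is" :: "3 list"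
  assume a: "local_parametrization cylinder V \<psi>" and l: "length is = 3"
  then have "open V" "smooth_map_on V \<psi>"
    by (auto simp: local_parametrization_def)
  then show "smooth_map_on V (components_in \<psi> cylinder_volume is)"
    using l by (auto simp: length_3_conv intro!: smooth_map_on_pderiv_dir smooth_map_on_frame_vol
      smooth_map_on_linear[OF _ bounded_linear_fst])
next
  fix p and vs :: "((real^3) \<times> real) list" and j u w a b
  assume "length vs = 3 \<and> set vs \<subseteq> tangent_space cylinder p" and "j < (3::nat)"
  moreover from this(2) have "j = 0 \<or> j = 1 \<or> j = 2" by auto
  ultimately show "cylinder_volume p (vs[j := a *\<^sub>R u + b *\<^sub>R w]) =
      a * cylinder_volume p (vs[j := u]) + b * cylinder_volume p (vs[j := w])"
    by (auto simp: cylinder_volume_def length_3_conv frame_vol_add frame_vol_scale numeral_2_eq_2)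
qed

lemma differential_form_volume: "differential_form TYPE(3) 3 cylinder cylinder_volume"
  using tensor_field_volume
  by (auto simp: differential_form_def cylinder_volume_def length_3_conv numeral_2_eq_2)

lemma riemannian_metric_cylinder: "riemannian_metric TYPE(3) cylinder cylinder_metric"
  using tensor_field_metric
  by (auto simp: riemannian_metric_def cylinder_metric_def inner_commute)

lemma vertical_tangent:
  assumes "p \<in> cylinder"
  shows "(0, t) \<in> tangent_space cylinder p"
  unfolding tangent_space_def
proof (intro CollectI exI conjI)
  show "((\<lambda>s. (fst p, snd p + s * t)) has_vector_derivative (0, t)) (at 0)"
    unfolding has_vector_derivative_def by (auto intro!: derivative_eq_intros)
qed (use assms in \<open>auto intro!: zero_less_one\<close>)

lemma vector_field_axial: "vector_field TYPE(3) cylinder axial_field"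
  unfolding vector_field_def
proof (intro conjI ballI allI impI)
  fix V and \<psi> :: "real^3 \<Rightarrow> (real^3) \<times> real"
  assume "local_parametrization cylinder V \<psi>"
  then have "open V" "smooth_map_on V \<psi>"
    by (auto simp: local_parametrization_def)
  moreover have "bounded_linear axial_field"
    unfolding axial_field_def[abs_def] by (rule bounded_linear_Pair[OF bounded_linear_zero bounded_linear_snd])
  ultimately show "smooth_map_on V (axial_field \<circ> \<psi>)"
    unfolding comp_def using smooth_map_on_linear by blast
qed (simp add: axial_field_def vertical_tangent)

lemma great_circle_tangent:
  assumes "norm a = 1" "norm b = 1" "a \<bullet> b = 0"
  shows "(b, 0) \<in> tangent_space cylinder (a, 0)"
  unfolding tangent_space_def
proof (intro CollectI exI conjI)
  show "((\<lambda>s. (cos s *\<^sub>R a + sin s *\<^sub>R b, 0::real)) has_vector_derivative (b, 0)) (at 0)"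
    unfolding has_vector_derivative_def by (auto intro!: derivative_eq_intros)
  have "(cos s *\<^sub>R a + sin s *\<^sub>R b) \<bullet> (cos s *\<^sub>R a + sin s *\<^sub>R b) = 1" for s
    using assms by (simp add: inner_simps inner_commute norm_eq_1 flip: power2_eq_square)
  then show "(\<lambda>s. (cos s *\<^sub>R a + sin s *\<^sub>R b, 0)) ` {-1<..<1} \<subseteq> cylinder"
    by (auto simp: norm_eq_1)
qed auto

lemma nonzero_volume: "nonzero_tensor 3 cylinder cylinder_volume"
  unfolding nonzero_tensor_def
proof (intro bexI exI conjI)
  let ?p = "(axis 1 1, 0) :: (real^3) \<times> real"
  show "?p \<in> cylinder"
    by simp
  show "set [(axis 2 1, 0), (axis 3 1, 0), (0, 1)] \<subseteq> tangent_space cylinder ?p"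
    using great_circle_tangent[of "axis 1 1" "axis 2 1"] great_circle_tangent[of "axis 1 1" "axis 3 1"]
      vertical_tangent[of ?p 1] by (simp add: inner_axis_axis)
  show "cylinder_volume ?p [(axis 2 1, 0), (axis 3 1, 0), (0, 1)] \<noteq> 0"
    by (simp add: cylinder_volume_def frame_vol_def cross_basis inner_axis_axis numeral_2_eq_2)
qed simp

lemma matrix_inv_mult:
  assumes "invertible A"
  shows "A ** matrix_inv A = mat 1" "matrix_inv A ** A = mat 1"
proof -
  have "A ** matrix_inv A = mat 1 \<and> matrix_inv A ** A = mat 1"
    using assms unfolding invertible_def matrix_inv_def by (rule someI_ex)
  then show "A ** matrix_inv A = mat 1" "matrix_inv A ** A = mat 1"
    by auto
qed

section \<open>Geometry in an arbitrary chart\<close>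

locale cylinder_chart =
  fixes V :: "(real^3) set" and \<psi> :: "real^3 \<Rightarrow> (real^3) \<times> real"
  assumes chart: "local_parametrization cylinder V \<psi>"
begin

abbreviation e :: "3 \<Rightarrow> real^3 \<Rightarrow> (real^3) \<times> real"
  where "e i \<equiv> pderiv_dir i \<psi>"

abbreviation G :: "3 components"
  where "G \<equiv> components_in \<psi> cylinder_metric"

abbreviation K :: "3 components"
  where "K \<equiv> components_in \<psi> cylinder_volume"

abbreviation n :: "real^3 \<Rightarrow> real^3"
  where "n x \<equiv> fst (\<psi> x)"

definition N :: "real^3 \<Rightarrow> (real^3) \<times> real"
  where "N x = (n x, 0)"

text \<open>The dual frame, with its index raised and viewed as ambient vectors. Once inverse
  metrics are hidden in it, every contraction is an expansion in a pair of dual bases.\<close>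

definition E :: "3 \<Rightarrow> real^3 \<Rightarrow> (real^3) \<times> real"
  where "E k x = (\<Sum>l\<in>UNIV. inverse_metric G k l x *\<^sub>R e l x)"

lemma open_V: "open V"
  using chart by (simp add: local_parametrization_def)

lemma smooth_\<psi>: "smooth_map_on V \<psi>"
  using chart by (simp add: local_parametrization_def)

lemma differentiable_\<psi>: "x \<in> V \<Longrightarrow> \<psi> differentiable at x"
  by (rule smooth_map_on_differentiable[OF smooth_\<psi> open_V])

lemma differentiable_e: "x \<in> V \<Longrightarrow> e i differentiable at x"
  by (rule smooth_map_on_differentiable[OF smooth_map_on_pderiv_dir[OF smooth_\<psi>] open_V])

lemma differentiable_de: "x \<in> V \<Longrightarrow> pderiv_dir j (e i) differentiable at x"
  by (rule smooth_map_on_differentiable[OF smooth_map_on_pderiv_dir[OF smooth_map_on_pderiv_dir[OF smooth_\<psi>]] open_V])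

lemma de_commute: "x \<in> V \<Longrightarrow> pderiv_dir i (e j) x = pderiv_dir j (e i) x"
  by (rule pderiv_dir_commute[OF open_V _ differentiable_\<psi> differentiable_e])

text \<open>The exchange of indices that removes the third derivatives of \<open>\<psi>\<close> from
  the Ricci tensor. The middle step differentiates the symmetry of second derivatives, which holds
  on all of \<open>V\<close>.\<close>

lemma dde_commute:
  assumes "x \<in> V"
  shows "pderiv_dir j (pderiv_dir i (e k)) x = pderiv_dir k (pderiv_dir i (e j)) x"
proof -
  have "pderiv_dir j (pderiv_dir i (e k)) x = pderiv_dir i (pderiv_dir j (e k)) x"
    by (rule pderiv_dir_commute[OF open_V assms differentiable_e differentiable_de])
  also have "\<dots> = pderiv_dir i (pderiv_dir k (e j)) x"
    by (rule pderiv_dir_cong_open[OF open_V assms differentiable_de[OF assms]]) (rule de_commute)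
  also have "\<dots> = pderiv_dir k (pderiv_dir i (e j)) x"
    by (rule pderiv_dir_commute[OF open_V assms differentiable_e differentiable_de])
  finally show ?thesis .
qed

lemma n_unit: "x \<in> V \<Longrightarrow> n x \<bullet> n x = 1"
proof -
  assume "x \<in> V"
  moreover have "\<psi> ` V \<subseteq> cylinder"
    using chart openin_imp_subset unfolding local_parametrization_def by metis
  ultimately have "\<psi> x \<in> cylinder"
    by blast
  then show ?thesis
    by (auto simp: mem_Times_iff norm_eq_1)
qed

lemma differentiable_n: "x \<in> V \<Longrightarrow> n differentiable at x"
  by (rule differentiable_fst_snd[OF differentiable_\<psi>])

lemma pderiv_dir_n: "x \<in> V \<Longrightarrow> pderiv_dir i n x = fst (e i x)"
  by (rule pderiv_dir_fst_snd[OF differentiable_\<psi>])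

lemma n_e: "x \<in> V \<Longrightarrow> n x \<bullet> fst (e i x) = 0"
proof -
  assume x: "x \<in> V"
  have "pderiv_dir i (\<lambda>y. n y \<bullet> n y) x = pderiv_dir i (\<lambda>y. 1) x"
    by (rule pderiv_dir_cong_open[OF open_V x]) (simp_all add: n_unit)
  then show ?thesis
    using pderiv_dir_inner[OF differentiable_n[OF x] differentiable_n[OF x], of i] pderiv_dir_n[OF x, of i]
    by (simp add: inner_commute)
qed

lemma inner_N: "u \<bullet> N x = fst u \<bullet> n x"
  by (simp add: N_def inner_prod_def)

lemma N_unit: "x \<in> V \<Longrightarrow> N x \<bullet> N x = 1"
  by (simp add: inner_N N_def n_unit)

lemma frame_vol_N [simp]:
  "frame_vol (n x) (N x) v w = 0" "frame_vol (n x) u (N x) w = 0" "frame_vol (n x) u v (N x) = 0"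
  by (simp_all add: N_def frame_vol_normal)

lemma normal_e: "x \<in> V \<Longrightarrow> e i x \<bullet> N x = 0"
  using n_e[of x i] by (simp add: inner_N inner_commute[of "n x"])

section \<open>The coordinate frame, its Gram matrix and the dual frame\<close>

lemma frame_independent:
  assumes "x \<in> V" "(\<Sum>i\<in>UNIV. c $ i *\<^sub>R e i x) = 0"
  shows "c = 0"
proof -
  have lin: "linear (frechet_derivative \<psi> (at x))"
    by (rule linear_frechet_derivative[OF differentiable_\<psi>[OF assms(1)]])
  have "frechet_derivative \<psi> (at x) c = 0"
    using frechet_derivative_expand[OF differentiable_\<psi>[OF assms(1)]] assms(2) by simp
  moreover have "inj (frechet_derivative \<psi> (at x))"
    using chart assms(1) by (simp add: local_parametrization_def)
  ultimately show ?thesis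
    using linear_injective_0[OF lin] by blast
qed

text \<open>A dimension count: coefficients and ambient vectors form the same space, so the linear
  map \<open>L\<close> is onto as soon as it is injective. The inner product with \<open>N\<close>
  isolates the normal coefficient, and independence of the frame handles the rest.\<close>

lemma frame_spans:
  assumes x: "x \<in> V"
  obtains c t where "u = (\<Sum>i\<in>UNIV. c $ i *\<^sub>R e i x) + t *\<^sub>R N x"
proof -
  define L where "L p = (\<Sum>i\<in>UNIV. fst p $ i *\<^sub>R e i x) + snd p *\<^sub>R N x"
    for p :: "(real^3) \<times> real"
  have "linear L"
    by (rule linearI) (simp_all add: L_def algebra_simps sum.distrib scaleR_sum_right)
  moreover have "inj L"
  proof -
    have "p = 0" if "L p = 0" for p
    proof -
      have "0 = L p \<bullet> N x"
        using that by simp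
      also have "\<dots> = snd p"
        using x by (simp add: L_def inner_add_left inner_sum_left normal_e N_unit)
      finally have "snd p = 0" by simp
      then show ?thesis
        using that frame_independent[OF x, of "fst p"] by (auto simp: L_def prod_eq_iff)
    qed
    then show ?thesis
      using linear_injective_0[OF \<open>linear L\<close>] by blast
  qed
  ultimately have "surj L"
    by (rule linear_injective_imp_surjective) simp
  then obtain p where "u = L p"
    by (metis surjD)
  then show ?thesis
    using that by (auto simp: L_def)
qed

definition gram :: "real^3 \<Rightarrow> real^3^3"
  where "gram x = (\<chi> a b. G [a, b] x)"

text \<open>The quadratic form of the Gram matrix at c is the squared norm of the combination of the
  frame vectors with coefficients c, so a kernel vector gives a vanishing combination.\<close>

lemma invertible_gram:
  assumes x: "x \<in> V"
  shows "invertible (gram x)"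
proof -
  have "c = 0" if "gram x *v c = 0" for c
  proof -
    let ?u = "\<Sum>i\<in>UNIV. c $ i *\<^sub>R e i x"
    have "?u \<bullet> ?u = (\<Sum>i\<in>UNIV. c $ i * (gram x *v c) $ i)"
      by (simp add: inner_sum_left inner_sum_right gram_def matrix_vector_mult_def sum_distrib_left mult_ac inner_commute)
    then have "?u = 0"
      using that by simp
    then show "c = 0"
      by (rule frame_independent[OF x])
  qed
  then show ?thesis
    unfolding invertible_left_inverse matrix_left_invertible_ker by blast
qed

lemma inverse_metric_eq: "inverse_metric G i j x = matrix_inv (gram x) $ i $ j"
  by (simp add: inverse_metric_def gram_def)

lemma dual_frame:
  assumes "x \<in> V"
  shows "E k x \<bullet> e m x = (if k = m then 1 else 0)"
proof -
  have "matrix_inv (gram x) ** gram x = mat 1"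
    by (rule matrix_inv_mult(2)[OF invertible_gram[OF assms]])
  moreover have "E k x \<bullet> e m x = (matrix_inv (gram x) ** gram x) $ k $ m"
    by (simp add: E_def inverse_metric_eq inner_sum_left matrix_matrix_mult_def) (simp add: gram_def)
  ultimately show ?thesis
    by (simp add: mat_def)
qed

lemma normal_E: "x \<in> V \<Longrightarrow> E k x \<bullet> N x = 0"
  by (simp add: E_def inner_sum_left normal_e)

text \<open>The difference \<open>w\<close> of the two sides is orthogonal to \<open>N\<close> and
  to all frame vectors. As these span, \<open>w\<close> is orthogonal to itself.\<close>

lemma completeness:
  assumes x: "x \<in> V"
  shows "u = (u \<bullet> N x) *\<^sub>R N x + (\<Sum>k\<in>UNIV. (u \<bullet> e k x) *\<^sub>R E k x)"
proof -
  define w where "w = u - (u \<bullet> N x) *\<^sub>R N x - (\<Sum>k\<in>UNIV. (u \<bullet> e k x) *\<^sub>R E k x)"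
  have we: "w \<bullet> e m x = 0" for m
    using x by (simp add: w_def inner_diff_left inner_sum_left normal_e inner_commute[of "N x"] dual_frame if_distrib cong: if_cong)
  have wn: "w \<bullet> N x = 0"
    using x by (simp add: w_def inner_diff_left inner_sum_left normal_E N_unit)
  obtain c t where c: "w = (\<Sum>i\<in>UNIV. c $ i *\<^sub>R e i x) + t *\<^sub>R N x"
    using frame_spans[OF x] .
  have "w \<bullet> w = w \<bullet> ((\<Sum>i\<in>UNIV. c $ i *\<^sub>R e i x) + t *\<^sub>R N x)"
    using c by simp
  also have "\<dots> = 0"
    unfolding inner_add_right inner_sum_right inner_scaleR_right by (simp only: we wn) simp
  finally have "w = 0"
    by simp
  then show ?thesis
    unfolding w_def by (simp only: diff_diff_eq right_minus_eq)
qed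

lemma inner_expand:
  assumes x: "x \<in> V"
  shows "u \<bullet> v = (u \<bullet> N x) * (v \<bullet> N x) + (\<Sum>k\<in>UNIV. (u \<bullet> e k x) * (v \<bullet> E k x))"
  by (subst completeness[OF x, of u])
    (simp only: inner_add_left inner_sum_left inner_scaleR_left, simp add: inner_commute)

text \<open>Contraction with the inverse metric is the ambient inner product of tangential parts;
  this is how the sums in \<open>H_squared\<close> are evaluated.\<close>

lemma inner_expand_metric:
  assumes x: "x \<in> V"
  shows "(\<Sum>p\<in>UNIV. \<Sum>q\<in>UNIV. inverse_metric G p q x * ((u \<bullet> e p x) * (v \<bullet> e q x)))
    = u \<bullet> v - (u \<bullet> N x) * (v \<bullet> N x)"
  unfolding inner_expand[OF x, of u v]
  by (simp add: E_def inner_sum_right sum_distrib_left mult_ac)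

text \<open>The dual form of \<open>completeness\<close>, obtained by testing against an arbitrary
  vector: \<open>inner_expand\<close> is symmetric under the exchange of the two bases.\<close>

lemma frame_expand:
  assumes x: "x \<in> V"
  shows "u = (u \<bullet> N x) *\<^sub>R N x + (\<Sum>k\<in>UNIV. (u \<bullet> E k x) *\<^sub>R e k x)"
proof -
  have "v \<bullet> u = v \<bullet> ((u \<bullet> N x) *\<^sub>R N x + (\<Sum>k\<in>UNIV. (u \<bullet> E k x) *\<^sub>R e k x))" for v
  proof -
    have "v \<bullet> ((u \<bullet> N x) *\<^sub>R N x + (\<Sum>k\<in>UNIV. (u \<bullet> E k x) *\<^sub>R e k x))
        = (u \<bullet> N x) * (v \<bullet> N x) + (\<Sum>k\<in>UNIV. (u \<bullet> E k x) * (v \<bullet> e k x))"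
      by (simp only: inner_add_right inner_sum_right inner_scaleR_right)
    also have "\<dots> = v \<bullet> u"
      by (subst inner_expand[OF x]) (simp only: mult.commute)
    finally show ?thesis ..
  qed
  then show ?thesis
    by (rule vector_eq_ldot[THEN iffD1, OF allI])
qed

subsection \<open>Differentiating the dual frame\<close>

lemma differentiable_det:
  fixes A :: "'a::real_normed_vector \<Rightarrow> real^'m::finite^'m"
  assumes "\<And>i j. (\<lambda>y. A y $ i $ j) differentiable at x"
  shows "(\<lambda>y. det (A y)) differentiable at x"
proof -
  obtain D where "\<And>i j. ((\<lambda>y. A y $ i $ j) has_derivative D i j) (at x)"
    using assms unfolding differentiable_def by metis
  then have "((\<lambda>y. \<Prod>i\<in>UNIV. A y $ i $ p i) has_derivative
      (\<lambda>h. \<Sum>i\<in>UNIV. D i (p i) h * (\<Prod>j\<in>UNIV - {i}. A x $ j $ p j))) (at x)" for p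
    by (intro has_derivative_prod) auto
  then have "(\<lambda>y. of_int (sign p) * (\<Prod>i\<in>UNIV. A y $ i $ p i)) differentiable at x" for p
    using differentiable_def by (intro differentiable_mult differentiable_const) blast
  then show ?thesis
    unfolding det_def by (intro differentiable_sum) (simp_all add: finite_permutations)
qed

text \<open>\<open>matrix_inv\<close> is defined by choice and offers nothing to differentiate. On
  \<open>V\<close> Cramer's rule writes its entries as quotients of determinants; \<open>?B\<close>
  is the Gram matrix with column \<open>k\<close> replaced by a basis vector.\<close>

lemma differentiable_inverse_metric:
  assumes x: "x \<in> V"
  shows "inverse_metric G k l differentiable at x"
proof -
  let ?B = "\<lambda>y. \<chi> i j. if j = k then axis l 1 $ i else gram y $ i $ j"
  have G: "(\<lambda>y. gram y $ i $ j) differentiable at x" for i j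
    by (simp add: gram_def bounded_bilinear.differentiable_prod[OF bounded_bilinear_inner]
      differentiable_e[OF x])
  then have B: "(\<lambda>y. ?B y $ i $ j) differentiable at x" for i j
    by (cases "j = k") simp_all
  have "det (gram x) \<noteq> 0"
    using invertible_gram[OF x] by (simp add: invertible_det_nz)
  then have "(\<lambda>y. det (?B y) / det (gram y)) differentiable at x"
    by (intro differentiable_divide differentiable_det G B)
  then show ?thesis
  proof (rule differentiable_cong_open[OF open_V x])
    fix y assume y: "y \<in> V"
    have "gram y *v (matrix_inv (gram y) *v axis l 1) = axis l 1"
      using matrix_inv_mult(1)[OF invertible_gram[OF y]] by (simp add: matrix_vector_mul_assoc)
    then have "matrix_inv (gram y) *v axis l 1 = (\<chi> k. det (\<chi> i j. if j = k then axis l 1 $ i else gram y $ i $ j) / det (gram y))"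
      using cramer invertible_gram[OF y] invertible_det_nz by blast
    then have "(matrix_inv (gram y) *v axis l 1) $ k = det (?B y) / det (gram y)"
      by simp
    then show "det (?B y) / det (gram y) = inverse_metric G k l y"
      by (simp add: inverse_metric_eq matrix_vector_mult_basis column_def)
  qed
qed

lemma differentiable_E: "x \<in> V \<Longrightarrow> E k differentiable at x"
  unfolding E_def[abs_def]
  by (intro differentiable_sum allI ballI differentiable_scaleR differentiable_inverse_metric differentiable_e) simp_all

text \<open>By the product rule and the symmetry of second derivatives, four of the six terms in the
  Christoffel symbol of the first kind cancel and the other two agree.\<close>

lemma christoffel_eq:
  assumes x: "x \<in> V"
  shows "christoffel G k i j x = E k x \<bullet> pderiv_dir i (e j) x"
proof -
  have d: "pderiv_dir a (\<lambda>x. e b x \<bullet> e c x) x = e b x \<bullet> pderiv_dir a (e c) x + pderiv_dir a (e b) x \<bullet> e c x" for a b c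
    by (rule pderiv_dir_inner[OF differentiable_e[OF x] differentiable_e[OF x]])
  have "pderiv_dir i (G [j, l]) x + pderiv_dir j (G [i, l]) x - pderiv_dir l (G [i, j]) x
      = 2 * (e l x \<bullet> pderiv_dir i (e j) x)" for l
    using de_commute[OF x, of i j] de_commute[OF x, of i l] de_commute[OF x, of j l]
    by (simp add: d inner_commute)
  then show ?thesis
    by (simp add: christoffel_def E_def inner_sum_left sum_distrib_left)
qed

lemma normal_de:
  assumes x: "x \<in> V"
  shows "pderiv_dir i (e j) x \<bullet> N x = - (fst (e i x) \<bullet> fst (e j x))"
proof -
  have "pderiv_dir i (\<lambda>y. n y \<bullet> fst (e j y)) x = pderiv_dir i (\<lambda>y. 0) x"
    by (rule pderiv_dir_cong_open[OF open_V x]) (simp_all add: n_e)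
  then show ?thesis
    using pderiv_dir_inner[OF differentiable_n[OF x] differentiable_fst_snd(1)[OF differentiable_e[OF x]], of i j]
    by (simp add: pderiv_dir_n[OF x] pderiv_dir_fst_snd[OF differentiable_e[OF x]] inner_N inner_commute[of "n x"])
qed

lemma normal_dE:
  assumes x: "x \<in> V"
  shows "pderiv_dir a (E k) x \<bullet> N x = - (fst (E k x) \<bullet> fst (e a x))"
proof -
  have "pderiv_dir a (\<lambda>y. fst (E k y) \<bullet> n y) x = pderiv_dir a (\<lambda>y. 0) x"
    by (rule pderiv_dir_cong_open[OF open_V x]) (use normal_E in \<open>simp_all add: inner_N\<close>)
  then show ?thesis
    using pderiv_dir_inner[OF differentiable_fst_snd(1)[OF differentiable_E[OF x]] differentiable_n[OF x], of a k]
    by (simp add: pderiv_dir_n[OF x] pderiv_dir_fst_snd[OF differentiable_E[OF x]] inner_N)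
qed

text \<open>Differentiating the constant pairing of the two frames moves the derivative from
  \<open>e\<close> to \<open>E\<close>, with a sign.\<close>

lemma dE_e:
  assumes x: "x \<in> V"
  shows "pderiv_dir a (E k) x \<bullet> e l x = - christoffel G k a l x"
proof -
  have "pderiv_dir a (\<lambda>y. E k y \<bullet> e l y) x = pderiv_dir a (\<lambda>y. if k = l then 1 else 0) x"
    by (rule pderiv_dir_cong_open[OF open_V x]) (simp_all add: dual_frame)
  then show ?thesis
    using pderiv_dir_inner[OF differentiable_E[OF x] differentiable_e[OF x], of a k l]
    by (simp add: christoffel_eq[OF x])
qed

text \<open>The derivative of \<open>E k\<close> is split by \<open>inner_expand\<close>: its normal
  part pairs with that of the second derivative of \<open>\<psi>\<close> to a product of second
  fundamental forms, its tangential part yields the quadratic sum.\<close>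

lemma pderiv_dir_christoffel:
  assumes x: "x \<in> V"
  shows "pderiv_dir a (christoffel G k i j) x =
    E k x \<bullet> pderiv_dir a (pderiv_dir i (e j)) x
    + (fst (E k x) \<bullet> fst (e a x)) * (fst (e i x) \<bullet> fst (e j x))
    - (\<Sum>l\<in>UNIV. christoffel G k a l x * christoffel G l i j x)"
proof -
  note d = differentiable_E[OF x] differentiable_de[OF x]
  have "pderiv_dir a (christoffel G k i j) x = pderiv_dir a (\<lambda>y. E k y \<bullet> pderiv_dir i (e j) y) x"
    by (rule pderiv_dir_cong_open[OF open_V x bounded_bilinear.differentiable_prod[OF bounded_bilinear_inner d]])
      (simp add: christoffel_eq)
  also have "\<dots> = E k x \<bullet> pderiv_dir a (pderiv_dir i (e j)) x + pderiv_dir a (E k) x \<bullet> pderiv_dir i (e j) x"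
    by (rule pderiv_dir_inner[OF d])
  also have "pderiv_dir a (E k) x \<bullet> pderiv_dir i (e j) x =
    (fst (E k x) \<bullet> fst (e a x)) * (fst (e i x) \<bullet> fst (e j x))
    - (\<Sum>l\<in>UNIV. christoffel G k a l x * christoffel G l i j x)"
    unfolding inner_expand[OF x, of "pderiv_dir a (E k) x"] normal_dE[OF x] normal_de[OF x] dE_e[OF x]
    by (simp add: christoffel_eq[OF x] inner_commute sum_negf)
  finally show ?thesis
    by simp
qed

text \<open>The identity of the tangent space has trace 3, and by completeness for the unit vector
  (0, 1) the vertical part accounts for 1 of it.\<close>

lemma trace_projection:
  assumes x: "x \<in> V"
  shows "(\<Sum>k\<in>UNIV. fst (E k x) \<bullet> fst (e k x)) = 2"
proof -
  have "(\<Sum>k\<in>UNIV. E k x \<bullet> e k x) = 3"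
    by (simp add: dual_frame[OF x])
  moreover have "(\<Sum>k\<in>UNIV. snd (E k x) * snd (e k x)) = 1"
    using inner_expand[OF x, of "(0, 1)" "(0, 1)"] by (simp add: inner_N, simp add: inner_prod_def mult.commute)
  ultimately show ?thesis
    by (simp add: inner_prod_def sum.distrib)
qed

text \<open>The quadratic sums from \<open>pderiv_dir_christoffel\<close> cancel those in the
  definition, and the third derivatives cancel by \<open>dde_commute\<close>. What is left is the
  traced Gauss equation: the projection to the sphere factor, times its trace 2, minus its square,
  which is itself.\<close>

lemma ricci_eq:
  assumes x: "x \<in> V"
  shows "ricci G i j x = fst (e i x) \<bullet> fst (e j x)"
proof -
  have "(\<Sum>k\<in>UNIV. (fst (E k x) \<bullet> fst (e j x)) * (fst (e i x) \<bullet> fst (e k x)))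
      = fst (e i x) \<bullet> fst (e j x)"
    using inner_expand[OF x, of "(fst (e i x), 0)" "(fst (e j x), 0)"] n_e[OF x]
    by (simp add: inner_N inner_commute[of _ "n x"], simp add: inner_prod_def inner_commute mult.commute)
  moreover have "(\<Sum>k\<in>UNIV. (fst (E k x) \<bullet> fst (e k x)) * (fst (e i x) \<bullet> fst (e j x)))
      = 2 * (fst (e i x) \<bullet> fst (e j x))"
    by (simp add: sum_distrib_right[symmetric] trace_projection[OF x])
  ultimately show ?thesis
    using dde_commute[OF x, of j i]
    by (simp add: ricci_def pderiv_dir_christoffel[OF x] sum_subtractf sum.distrib)
qed

subsection \<open>The torsion form\<close>

text \<open>Contracting \<open>k\<close> and \<open>l\<close> gives an inner product of two
  \<open>frame_cross\<close> vectors, which are tangent. After Binet-Cauchy the remaining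
  contraction is the trace 3 times the metric, minus the metric.\<close>

lemma H_squared_eq:
  assumes x: "x \<in> V"
  shows "H_squared G K i j x = 2 * G [i, j] x"
proof -
  let ?g = "\<lambda>p q. inverse_metric G p q x"
  have cross_normal: "frame_cross (n x) u v \<bullet> N x = 0" for u v
    by (simp add: frame_vol_eq_inner[symmetric])
  have "H_squared G K i j x = (\<Sum>p\<in>UNIV. \<Sum>q\<in>UNIV. ?g p q * (\<Sum>k\<in>UNIV. \<Sum>l\<in>UNIV. ?g k l *
      ((frame_cross (n x) (e i x) (e p x) \<bullet> e k x) * (frame_cross (n x) (e j x) (e q x) \<bullet> e l x))))"
    by (simp add: H_squared_def frame_vol_eq_inner sum_distrib_left mult.assoc)
  also have "\<dots> = (\<Sum>p\<in>UNIV. \<Sum>q\<in>UNIV. ?g p q *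
      (frame_cross (n x) (e i x) (e p x) \<bullet> frame_cross (n x) (e j x) (e q x)))"
    by (simp add: inner_expand_metric[OF x] cross_normal)
  also have "\<dots> = (\<Sum>p\<in>UNIV. \<Sum>q\<in>UNIV. ?g p q *
      ((e i x \<bullet> e j x) * (e p x \<bullet> e q x) - (e i x \<bullet> e q x) * (e p x \<bullet> e j x)))"
    by (simp add: inner_frame_cross n_unit[OF x] n_e[OF x])
  also have "\<dots> = (e i x \<bullet> e j x) * (\<Sum>p\<in>UNIV. \<Sum>q\<in>UNIV. ?g p q * (e p x \<bullet> e q x))
      - (\<Sum>p\<in>UNIV. \<Sum>q\<in>UNIV. ?g p q * ((e j x \<bullet> e p x) * (e i x \<bullet> e q x)))"
    by (simp add: sum_distrib_left sum_subtractf[symmetric] algebra_simps inner_commute)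
  also have "(\<Sum>p\<in>UNIV. \<Sum>q\<in>UNIV. ?g p q * (e p x \<bullet> e q x)) = (\<Sum>p\<in>UNIV. E p x \<bullet> e p x)"
    by (simp add: E_def inner_sum_left, simp add: inner_commute)
  also have "\<dots> = 3"
    by (simp add: dual_frame[OF x])
  also have "(\<Sum>p\<in>UNIV. \<Sum>q\<in>UNIV. ?g p q * ((e j x \<bullet> e p x) * (e i x \<bullet> e q x))) = e i x \<bullet> e j x"
    unfolding inner_expand_metric[OF x] by (simp add: normal_e[OF x], simp add: inner_commute)
  finally show ?thesis
    by simp
qed

text \<open>The derivative of the normal is tangent to the sphere, so the first of the four Leibniz
  terms vanishes by \<open>frame_vol_tangent\<close>.\<close>

lemma pderiv_dir_K:
  assumes x: "x \<in> V"
  shows "pderiv_dir p (K [i, j, k]) x =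
    frame_vol (n x) (pderiv_dir p (e i) x) (e j x) (e k x)
    + frame_vol (n x) (e i x) (pderiv_dir p (e j) x) (e k x)
    + frame_vol (n x) (e i x) (e j x) (pderiv_dir p (e k) x)"
  using pderiv_dir_frame_vol(2)[OF differentiable_n[OF x] differentiable_e[OF x] differentiable_e[OF x]
      differentiable_e[OF x], of p i j k]
  by (simp add: pderiv_dir_n[OF x] frame_vol_tangent[OF n_unit[OF x]] n_e[OF x])

lemma de_expand:
  assumes x: "x \<in> V"
  shows "pderiv_dir p (e i) x =
    (pderiv_dir p (e i) x \<bullet> N x) *\<^sub>R N x + (\<Sum>m\<in>UNIV. christoffel G m p i x *\<^sub>R e m x)"
  using frame_expand[OF x, of "pderiv_dir p (e i) x"] by (simp add: christoffel_eq[OF x] inner_commute)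

text \<open>The normal part of a differentiated frame vector is annihilated by the volume form; the
  tangential part is exactly the Christoffel correction.\<close>

lemma covariant_derivative_K:
  assumes x: "x \<in> V"
  shows "covariant_derivative G p K [q, i, j] x = 0"
proof -
  have 1: "frame_vol (n x) (pderiv_dir p (e a) x) v w = (\<Sum>m\<in>UNIV. christoffel G m p a x * frame_vol (n x) (e m x) v w)" for a v w
    by (subst de_expand[OF x]) (simp add: frame_vol_add frame_vol_scale frame_vol_sum)
  have 2: "frame_vol (n x) v (pderiv_dir p (e a) x) w = (\<Sum>m\<in>UNIV. christoffel G m p a x * frame_vol (n x) v (e m x) w)" for a v w
    by (subst de_expand[OF x]) (simp add: frame_vol_add frame_vol_scale frame_vol_sum)
  have 3: "frame_vol (n x) v w (pderiv_dir p (e a) x) = (\<Sum>m\<in>UNIV. christoffel G m p a x * frame_vol (n x) v w (e m x))" for a v w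
    by (subst de_expand[OF x]) (simp add: frame_vol_add frame_vol_scale frame_vol_sum)
  have "{..<length [q, i, j]} = {0, 1, 2}"
    by auto
  then show ?thesis
    unfolding covariant_derivative_def pderiv_dir_K[OF x] 1 2 3 by (simp del: lessThan_Suc add: numeral_2_eq_2)
qed

lemma exterior_derivative_K:
  assumes x: "x \<in> V" and l: "length js = 4"
  shows "exterior_derivative K js x = 0"
proof -
  obtain a b c d where js: "js = [a, b, c, d]"
    using l by (auto simp: numeral_eq_Suc length_Suc_conv)
  have "exterior_derivative K js x = pderiv_dir a (K [b, c, d]) x - pderiv_dir b (K [a, c, d]) x
      + pderiv_dir c (K [a, b, d]) x - pderiv_dir d (K [a, b, c]) x"
    unfolding exterior_derivative_def js by (simp del: components_volume add: lessThan_Suc numeral_eq_Suc)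
  also have "\<dots> = 0"
    unfolding pderiv_dir_K[OF x] de_commute[OF x, of b a] de_commute[OF x, of c a] de_commute[OF x, of d a]
      de_commute[OF x, of c b] de_commute[OF x, of d b] de_commute[OF x, of d c]
    \<comment> \<open>Each second derivative of \<open>\<psi>\<close> now occurs in two terms. The
      pairs ab, bc and cd cancel as they stand, ac and bd after one transposition, ad after
      two.\<close>
    using frame_vol_swap(1)[of "n x" "e b x" "pderiv_dir a (e c) x" "e d x"]
      frame_vol_swap(1)[of "n x" "e b x" "pderiv_dir a (e d) x" "e c x"]
      frame_vol_swap(2)[of "n x" "e b x" "e c x" "pderiv_dir a (e d) x"]
      frame_vol_swap(2)[of "n x" "e a x" "e c x" "pderiv_dir b (e d) x"]
    by linarith
  finally show ?thesis .
qed

lemma codifferential_K: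
  assumes "x \<in> V"
  shows "codifferential G K [i, j] x = 0"
  by (simp add: codifferential_def covariant_derivative_K[OF assms])

lemma pderiv_dir_vanishing:
  assumes "x \<in> V" "\<And>y. y \<in> V \<Longrightarrow> f y = 0"
  shows "pderiv_dir i f x = 0"
  using pderiv_dir_cong_open[OF open_V assms(1), of "\<lambda>y. 0" f i] assms(2) by simp

text \<open>The form is closed and coclosed on all of \<open>V\<close>, so the outer derivatives in
  both summands act on functions that vanish near \<open>x\<close>.\<close>

lemma hodge_laplacian_K:
  assumes x: "x \<in> V"
  shows "hodge_laplacian G K [i, j, k] x = 0"
proof -
  have "exterior_derivative (codifferential G K) [i, j, k] x = 0"
    unfolding exterior_derivative_def
    by (simp add: lessThan_Suc pderiv_dir_vanishing[OF x codifferential_K])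
  moreover have "covariant_derivative G p (exterior_derivative K) [q, i, j, k] x = 0" for p q
    unfolding covariant_derivative_def
    by (simp add: exterior_derivative_K[OF x] pderiv_dir_vanishing[OF x exterior_derivative_K])
  ultimately show ?thesis
    by (simp add: hodge_laplacian_def codifferential_def)
qed

subsection \<open>The vector field\<close>

abbreviation Y :: "real^3 \<Rightarrow> real^3"
  where "Y \<equiv> vector_components \<psi> axial_field"

text \<open>Coefficients in the frame are inner products with the dual frame, and
  \<open>frame_independent\<close> makes the description by \<open>THE\<close> unambiguous. The
  explicit formula supplies differentiability.\<close>

lemma Y_component:
  assumes x: "x \<in> V"
  shows "Y x $ m = snd (\<psi> x) * snd (E m x)"
proof -
  define c :: "real^3" where "c = (\<chi> m. snd (\<psi> x) * snd (E m x))"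
  have c: "axial_field (\<psi> x) = (\<Sum>i\<in>UNIV. c $ i *\<^sub>R e i x)"
    using frame_expand[OF x, of "axial_field (\<psi> x)"]
    by (simp add: c_def axial_field_def inner_N, simp add: inner_prod_def)
  have "Y x = c"
    unfolding vector_components_def
  proof (rule the_equality)
    show "axial_field (\<psi> x) = (\<Sum>i\<in>UNIV. c $ i *\<^sub>R e i x)"
      by (rule c)
  next
    fix b
    assume "axial_field (\<psi> x) = (\<Sum>i\<in>UNIV. b $ i *\<^sub>R e i x)"
    with c have "(\<Sum>i\<in>UNIV. (b - c) $ i *\<^sub>R e i x) = 0"
      by (simp add: scaleR_diff_left sum_subtractf)
    from frame_independent[OF x this] show "b = c"
      by simp
  qed
  then show ?thesis
    by (simp add: c_def)
qed

lemma Y_expand: "x \<in> V \<Longrightarrow> (\<Sum>m\<in>UNIV. Y x $ m *\<^sub>R e m x) = axial_field (\<psi> x)"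
  using frame_expand[of x "axial_field (\<psi> x)"] by (simp add: Y_component axial_field_def inner_N, simp add: inner_prod_def)

lemma differentiable_Y:
  assumes x: "x \<in> V"
  shows "(\<lambda>y. Y y $ m) differentiable at x"
  by (rule differentiable_cong_open[OF open_V x, of "\<lambda>y. snd (\<psi> y) * snd (E m y)"])
    (simp_all add: Y_component differentiable_mult differentiable_fst_snd differentiable_\<psi>[OF x] differentiable_E[OF x])

text \<open>Differentiating \<open>Y_expand\<close> produces precisely the combination that enters
  Lie derivatives, without computing any single derivative of \<open>Y\<close>. Its last sum cancels
  the transport term there.\<close>

lemma dY_expand:
  assumes x: "x \<in> V"
  shows "(\<Sum>m\<in>UNIV. pderiv_dir i (\<lambda>y. Y y $ m) x *\<^sub>R e m x) =
    (0, snd (e i x)) - (\<Sum>m\<in>UNIV. Y x $ m *\<^sub>R pderiv_dir m (e i) x)"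
proof -
  note d = bounded_bilinear.differentiable_prod[OF bounded_bilinear_scaleR differentiable_Y[OF x] differentiable_e[OF x]]
  have ax: "bounded_linear axial_field"
    unfolding axial_field_def[abs_def] by (rule bounded_linear_Pair[OF bounded_linear_zero bounded_linear_snd])
  have "(0, snd (e i x)) = pderiv_dir i (\<lambda>y. axial_field (\<psi> y)) x"
    by (simp add: bounded_linear.pderiv_dir_linear[OF ax differentiable_\<psi>[OF x]]) (simp add: axial_field_def)
  also have "\<dots> = pderiv_dir i (\<lambda>y. \<Sum>m\<in>UNIV. Y y $ m *\<^sub>R e m y) x"
    by (rule pderiv_dir_cong_open[OF open_V x]) (simp_all add: Y_expand differentiable_sum d)
  also have "\<dots> = (\<Sum>m\<in>UNIV. Y x $ m *\<^sub>R pderiv_dir i (e m) x + pderiv_dir i (\<lambda>y. Y y $ m) x *\<^sub>R e m x)"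
    by (simp add: pderiv_dir_sum[OF d] pderiv_dir_scaleR[OF differentiable_Y[OF x] differentiable_e[OF x]])
  finally show ?thesis
    using de_commute[OF x, of i] by (simp add: sum.distrib)
qed

lemma lie_derivative_G:
  assumes x: "x \<in> V"
  shows "lie_derivative Y G [i, j] x = 2 * snd (e i x) * snd (e j x)"
proof -
  let ?dY = "\<lambda>i. \<Sum>m\<in>UNIV. pderiv_dir i (\<lambda>y. Y y $ m) x *\<^sub>R e m x"
  have "lie_derivative Y G [i, j] x =
      (\<Sum>m\<in>UNIV. Y x $ m * (e i x \<bullet> pderiv_dir m (e j) x + pderiv_dir m (e i) x \<bullet> e j x))
      + (?dY i \<bullet> e j x + e i x \<bullet> ?dY j)"
    unfolding lie_derivative_def
    by (simp add: lessThan_Suc pderiv_dir_inner[OF differentiable_e[OF x] differentiable_e[OF x]]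
      inner_sum_left inner_sum_right)
  also have "\<dots> = 2 * snd (e i x) * snd (e j x)"
    unfolding dY_expand[OF x]
    by (simp add: inner_diff_left inner_diff_right inner_sum_left inner_sum_right sum.distrib
      distrib_left) (simp add: inner_prod_def)
  finally show ?thesis .
qed

lemma lie_derivative_K:
  assumes x: "x \<in> V"
  shows "lie_derivative Y K [i, j, k] x = K [i, j, k] x"
proof -
  let ?dY = "\<lambda>i. \<Sum>m\<in>UNIV. pderiv_dir i (\<lambda>y. Y y $ m) x *\<^sub>R e m x"
  let ?v = "frame_vol (n x)"
  have dY: "?v (?dY a) v w = (\<Sum>m\<in>UNIV. pderiv_dir a (\<lambda>y. Y y $ m) x * ?v (e m x) v w)"
    "?v v (?dY a) w = (\<Sum>m\<in>UNIV. pderiv_dir a (\<lambda>y. Y y $ m) x * ?v v (e m x) w)"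
    "?v v w (?dY a) = (\<Sum>m\<in>UNIV. pderiv_dir a (\<lambda>y. Y y $ m) x * ?v v w (e m x))" for a v w
    by (simp_all only: frame_vol_sum frame_vol_scale)
  have "{..<length [i, j, k]} = {0, 1, 2}"
    by auto
  then have "lie_derivative Y K [i, j, k] x =
      (\<Sum>m\<in>UNIV. Y x $ m * pderiv_dir m (K [i, j, k]) x)
      + (?v (?dY i) (e j x) (e k x) + ?v (e i x) (?dY j) (e k x) + ?v (e i x) (e j x) (?dY k))"
    unfolding lie_derivative_def dY by (simp del: lessThan_Suc add: numeral_2_eq_2)
  also have "\<dots> = ?v (0, snd (e i x)) (e j x) (e k x) + ?v (e i x) (0, snd (e j x)) (e k x)
      + ?v (e i x) (e j x) (0, snd (e k x))"
    unfolding dY_expand[OF x] pderiv_dir_K[OF x] frame_vol_diff frame_vol_sum frame_vol_scale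
    by (simp add: sum.distrib distrib_left)
  \<comment> \<open>Replacing one argument by its vertical part keeps exactly one of the three terms
    in the definition of \<open>frame_vol\<close>; this is div X = 1.\<close>
  also have "\<dots> = ?v (e i x) (e j x) (e k x)"
    by (simp add: frame_vol_def)
  finally show ?thesis
    by simp
qed

end

theorem mainTheorem5:
  "\<exists>g H X lam. generalized_soliton TYPE(3) (sphere (0 :: real^3) 1 \<times> (UNIV :: real set)) g H X lam
     \<and> nonzero_tensor 3 (sphere (0 :: real^3) 1 \<times> (UNIV :: real set)) H \<and> lam > 0"
proof (intro exI conjI)
  have closed: "closed_form TYPE(3) 3 cylinder cylinder_volume"
    unfolding closed_form_def
    using differential_form_volume cylinder_chart.exterior_derivative_K[OF cylinder_chart.intro] by simp
  show "generalized_soliton TYPE(3) cylinder cylinder_metric cylinder_volume axial_field 1"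
    unfolding generalized_soliton_def Let_def
  proof (intro conjI allI impI ballI)
    fix V and \<psi> :: "real^3 \<Rightarrow> (real^3) \<times> real" and x and i j k :: 3
    assume "local_parametrization cylinder V \<psi>" and x: "x \<in> V"
    then interpret cylinder_chart V \<psi>
      by unfold_locales
    \<comment> \<open>With h the spherical part of the metric and s = dz, g = h + s^2, so that 2 h -
      g = g - 2 s^2.\<close>
    show "2 * ricci G i j x - 1/2 * H_squared G K i j x = 1 * G [i, j] x - lie_derivative Y G [i, j] x"
      by (simp add: ricci_eq[OF x] H_squared_eq[OF x] lie_derivative_G[OF x] inner_prod_def field_simps)
    show "hodge_laplacian G K [i, j, k] x = 1 * K [i, j, k] x - lie_derivative Y K [i, j, k] x"
      by (simp only: hodge_laplacian_K[OF x] lie_derivative_K[OF x])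
  qed (simp_all add: smooth_submanifold_cylinder riemannian_metric_cylinder closed vector_field_axial)
  show "nonzero_tensor 3 cylinder cylinder_volume"
    by (rule nonzero_volume)
qed simp

end
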